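(* Suppose that $\{x\in\mathbb{R}^n:Ax=b\}$ is nonempty, that $f:\mathbb{R}^n\to\mathbb{R}$ is proper, lower semicontinuous and $\rho$-weakly convex ($\rho>0$), and that $f$ satisfies the implicit Lipschitz subgradient property with constant $L_f>0$ (possibly depending on $\gamma$). Let $\gamma\in(0,\rho^{-1})$, $\eta\in(0,2)$, and let $\beta_k=\beta$ for all $k$, with $\beta$ sufficiently large such that $$\alpha:=\frac{2\beta+\gamma\eta(1-\eta/2)}{2c_{\gamma,A}\beta^2}<\min\left\{\frac{1-\gamma\rho}{4\gamma(1+\gamma L_f)^2},\ \frac{1}{8\gamma}\Big(\frac{2}{\eta}-1\Big)\right\}.$$ Let $\{(x^k,z^k,\lambda^k)\}$ be generated by MEAL, suppose $\{\mathcal{E}^k_{\mathrm{meal}}\}_{k\ge1}$ is lower bounded, and suppose $\{(x^k,z^k,\lambda^k)\}$ is bounded. If $\mathcal{P}_{\mathrm{meal}}$ satisfies the Kurdyka-{\L}ojasiewicz property at some point $y^*:=(x^*,x^*,\lambda^*,x^* )$ with an exponent $\theta\in[0,1)$, where $(x^*,\lambda^* )$ is a limit point of $\{(x^k,\lambda^k)\}$, then: (a) the whole sequence $\{\hat y^k:=(x^k,z^k,\lambda^k)\}$ converges to $\hat y^*:=(x^*,x^*,\lambda^* )$; and (b) the following rates hold: (1) if $\theta=0$, then $\{\hat y^k\}$ converges within a finite number of iterations; (2) if $\theta\in(0,\frac12]$, then $\|\hat y^k-\hat y^*\|\le c\tau^k$ for all $k\ge k_0$, for certain $k_0>0$, $c>0$,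 $\tau\in(0,1)$; (3) if $\theta\in(\frac12,1)$, then $\|\hat y^k-\hat y^*\|\le c\,k^{-\frac{1-\theta}{2\theta-1}}$ for all $k\ge k_0$, for certain $k_0>0$, $c>0$.
   Context: The problem is to minimize $f(x)$ over $x\in\mathbb{R}^n$ subject to $Ax=b$, with $A\in\mathbb{R}^{m\times n}$, $b\in\mathbb{R}^m$. $\|\cdot\|$ is the Euclidean norm. A function $h$ is $\rho$-weakly convex ($\rho>0$) if $h+\frac{\rho}{2}\|\cdot\|^2$ is convex. Moreau envelope and prox: $\mathcal{M}_{\gamma,h}(z)=\min_x\{h(x)+\frac1{2\gamma}\|x-z\|^2\}$, $\mathrm{Prox}_{\gamma,h}(z)=\operatorname{argmin}_x\{h(x)+\frac1{2\gamma}\|x-z\|^2\}$. If $h$ is proper, lower semicontinuous, $\rho$-weakly convex and $\gamma\in(0,\rho^{-1})$, the prox is single-valued and $\mathcal{M}_{\gamma,h}$ is differentiable with $\nabla\mathcal{M}_{\gamma,h}(z)=\gamma^{-1}(z-\mathrm{Prox}_{\gamma,h}(z))$. For $x\in\mathrm{ran}(\mathrm{Prox}_{\gamma,h})$ let $\mathrm{Prox}_{\gamma,h}^{-1}(x)=\{w:\mathrm{Prox}_{\gamma,h}(w)=x\}$. Implicit Lipschitz subgradient property of $h$: for any $\gamma\in(0,\rho^{-1})$ there is $L>0$ (depending on $\gamma$) such that for all $u,v\in\mathrm{ran}(\mathrm{Prox}_{\gamma,h})$, all $w\in\mathrm{Prox}_{\gamma,h}^{-1}(u)$ and $w'\in\mathrm{Prox}_{\gamma,h}^{-1}(v)$: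 $\|\nabla\mathcal{M}_{\gamma,h}(w)-\nabla\mathcal{M}_{\gamma,h}(w')\|\le L\|u-v\|$. For $\beta>0$: $\mathcal{L}_\beta(x,\lambda)=f(x)+\langle\lambda,Ax-b\rangle+\frac\beta2\|Ax-b\|^2$ and $\mathcal{P}_\beta(x,z,\lambda)=\mathcal{L}_\beta(x,\lambda)+\frac1{2\gamma}\|x-z\|^2$. MEAL with fixed $\beta$: given $(z^0,\lambda^0)$, for $k=0,1,\dots$: $x^{k+1}=\operatorname{argmin}_x\{\mathcal{L}_{\beta}(x,\lambda^k)+\frac1{2\gamma}\|x-z^k\|^2\}$, $z^{k+1}=z^k-\eta(z^k-x^{k+1})$, $\lambda^{k+1}=\lambda^k+\beta(Ax^{k+1}-b)$. $c_{\gamma,A}=\gamma^2\tilde\sigma_{\min}(A^TA)$, where $\tilde\sigma_{\min}(A^TA)$ is the smallest positive eigenvalue of $A^TA$. For $k\ge1$, $\mathcal{E}^k_{\mathrm{meal}}=\mathcal{P}_{\beta}(x^k,z^k,\lambda^k)+2\alpha\|z^k-z^{k-1}\|^2$. For $y=(x,z,\lambda,\hat z)\in\mathbb{R}^n\times\mathbb{R}^n\times\mathbb{R}^m\times\mathbb{R}^n$, $\mathcal{P}_{\mathrm{meal}}(y)=\mathcal{P}_\beta(x,z,\lambda)+3\alpha\|z-\hat z\|^2$. Limiting subdifferential: the Fr\'echet subdifferential $\widehat\partial h(x)$ at $x\in\mathrm{dom}(h)$ is the set of $v$ with $\liminf_{u\ne x,u\to x}\frac{h(u)-h(x)-\langle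 v,u-x\rangle}{\|x-u\|}\ge0$ (empty if $x\notin\mathrm{dom}(h)$), and $\partial h(x)=\{v:\exists x^t\to x,\ h(x^t)\to h(x),\ \widehat\partial h(x^t)\ni v^t\to v\}$. Kurdyka-{\L}ojasiewicz property: $h$ has it at $x^*\in\mathrm{dom}(\partial h)$ with exponent $\theta\in[0,1)$ if there exist a neighborhood $\mathcal{U}$ of $x^*$, $\nu>0$ and $\varphi(s)=cs^{1-\theta}$ with $c>0$ such that for all $x\in\mathcal{U}\cap\mathrm{dom}(\partial h)$ with $h(x^* )<h(x)<h(x^* )+\nu$: $\varphi'(h(x)-h(x^* ))\cdot\mathrm{dist}(0,\partial h(x))\ge1$ (conventions $0^0=1$, $\infty/\infty=0/0=0$), where $\mathrm{dist}(x,S)=\inf_{u\in S}\|x-u\|$. *)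

theory Defs
  imports "HOL-Analysis.Analysis"
begin

(* All functions are real-valued, so they are automatically proper and their domain is the
   whole space. *)

definition lower_semicontinuous :: "('a::topological_space \<Rightarrow> real) \<Rightarrow> bool" where
  "lower_semicontinuous h \<longleftrightarrow> (\<forall>x. ereal (h x) \<le> Liminf (at x) (\<lambda>u. ereal (h u)))"

definition weakly_convex :: "real \<Rightarrow> ('a::real_inner \<Rightarrow> real) \<Rightarrow> bool" where
  "weakly_convex \<rho> h \<longleftrightarrow> \<rho> > 0 \<and> convex_on UNIV (\<lambda>x. h x + \<rho> / 2 * (norm x)\<^sup>2)"

definition gradient :: "('a::real_inner \<Rightarrow> real) \<Rightarrow> 'a \<Rightarrow> 'a" where
  "gradient h z = (THE g. GDERIV h z :> g)"

(* For a lower semicontinuous \<rho>-weakly convex h on a Euclidean space and 0 < \<gamma> < 1 / \<rho>, the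
   infimum is attained at exactly one point; only this case is used. *)
definition moreau_envelope :: "real \<Rightarrow> ('a::real_inner \<Rightarrow> real) \<Rightarrow> 'a \<Rightarrow> real" where
  "moreau_envelope \<gamma> h z = (INF x. h x + 1 / (2 * \<gamma>) * (norm (x - z))\<^sup>2)"

definition prox :: "real \<Rightarrow> ('a::real_inner \<Rightarrow> real) \<Rightarrow> 'a \<Rightarrow> 'a" where
  "prox \<gamma> h z = arg_min (\<lambda>x. h x + 1 / (2 * \<gamma>) * (norm (x - z))\<^sup>2) (\<lambda>_. True)"

(* L assigns to each \<gamma> the Lipschitz constant belonging to it. *)
definition implicit_Lipschitz_subgradient ::
  "real \<Rightarrow> ('a::real_inner \<Rightarrow> real) \<Rightarrow> (real \<Rightarrow> real) \<Rightarrow> bool" where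
  "implicit_Lipschitz_subgradient \<rho> h L \<longleftrightarrow>
     (\<forall>\<gamma>. 0 < \<gamma> \<and> \<gamma> < 1 / \<rho> \<longrightarrow> L \<gamma> > 0 \<and>
       (\<forall>u \<in> range (prox \<gamma> h). \<forall>v \<in> range (prox \<gamma> h).
        \<forall>w \<in> prox \<gamma> h -` {u}. \<forall>w' \<in> prox \<gamma> h -` {v}.
          norm (gradient (moreau_envelope \<gamma> h) w - gradient (moreau_envelope \<gamma> h) w')
            \<le> L \<gamma> * norm (u - v)))"

definition frechet_subdifferential :: "('a::real_inner \<Rightarrow> real) \<Rightarrow> 'a \<Rightarrow> 'a set" where
  "frechet_subdifferential h x =
     {v. Liminf (at x) (\<lambda>u. ereal ((h u - h x - v \<bullet> (u - x)) / norm (x - u))) \<ge> 0}"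

definition limiting_subdifferential :: "('a::real_inner \<Rightarrow> real) \<Rightarrow> 'a \<Rightarrow> 'a set" where
  "limiting_subdifferential h x =
     {v. \<exists>xs vs. xs \<longlonglongrightarrow> x \<and> (\<lambda>t. h (xs t)) \<longlonglongrightarrow> h x \<and>
           (\<forall>t. vs t \<in> frechet_subdifferential h (xs t)) \<and> vs \<longlonglongrightarrow> v}"

definition dom_subdifferential :: "('a::real_inner \<Rightarrow> real) \<Rightarrow> 'a set" where
  "dom_subdifferential h = {x. limiting_subdifferential h x \<noteq> {}}"

(* Only s = h x - h p > 0 and nonempty subdifferentials occur, so neither the convention for
   0 to the power 0 nor the distance to the empty set (0 for infdist) matters. *)
definition KL_property :: "('a::real_inner \<Rightarrow> real) \<Rightarrow> 'a \<Rightarrow> real \<Rightarrow> bool" where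
  "KL_property h p \<theta> \<longleftrightarrow>
     0 \<le> \<theta> \<and> \<theta> < 1 \<and> p \<in> dom_subdifferential h \<and>
     (\<exists>U \<nu> c. open U \<and> p \<in> U \<and> \<nu> > 0 \<and> c > 0 \<and>
        (\<forall>x \<in> U \<inter> dom_subdifferential h. h p < h x \<and> h x < h p + \<nu> \<longrightarrow>
           deriv (\<lambda>s. c * s powr (1 - \<theta>)) (h x - h p)
             * infdist 0 (limiting_subdifferential h x) \<ge> 1))"

definition aug_Lagrangian ::
  "(real^'n \<Rightarrow> real) \<Rightarrow> real^'n^'m \<Rightarrow> real^'m \<Rightarrow> real \<Rightarrow> real^'n \<Rightarrow> real^'m \<Rightarrow> real" where
  "aug_Lagrangian f A b \<beta> x l =
     f x + l \<bullet> (A *v x - b) + \<beta> / 2 * (norm (A *v x - b))\<^sup>2"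

definition prox_aug_Lagrangian ::
  "(real^'n \<Rightarrow> real) \<Rightarrow> real^'n^'m \<Rightarrow> real^'m \<Rightarrow> real \<Rightarrow> real
    \<Rightarrow> real^'n \<Rightarrow> real^'n \<Rightarrow> real^'m \<Rightarrow> real" where
  "prox_aug_Lagrangian f A b \<gamma> \<beta> x z l =
     aug_Lagrangian f A b \<beta> x l + 1 / (2 * \<gamma>) * (norm (x - z))\<^sup>2"

(* x 0 is not produced by the method and is left unconstrained. *)
definition MEAL ::
  "(real^'n \<Rightarrow> real) \<Rightarrow> real^'n^'m \<Rightarrow> real^'m \<Rightarrow> real \<Rightarrow> real \<Rightarrow> real
    \<Rightarrow> (nat \<Rightarrow> real^'n) \<Rightarrow> (nat \<Rightarrow> real^'n) \<Rightarrow> (nat \<Rightarrow> real^'m) \<Rightarrow> bool" where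
  "MEAL f A b \<gamma> \<beta> \<eta> x z l \<longleftrightarrow>
     (\<forall>k. is_arg_min (\<lambda>u. aug_Lagrangian f A b \<beta> u (l k) + 1 / (2 * \<gamma>) * (norm (u - z k))\<^sup>2)
            (\<lambda>_. True) (x (Suc k)) \<and>
          z (Suc k) = z k - \<eta> *\<^sub>R (z k - x (Suc k)) \<and>
          l (Suc k) = l k + \<beta> *\<^sub>R (A *v x (Suc k) - b))"

(* Meaningful only if M has a positive eigenvalue; for M = A\<^sup>T A this means A \<noteq> 0. *)
definition smallest_pos_eigenvalue :: "real^'n^'n \<Rightarrow> real" where
  "smallest_pos_eigenvalue M = (LEAST \<mu>. \<mu> > 0 \<and> (\<exists>v. v \<noteq> 0 \<and> M *v v = \<mu> *\<^sub>R v))"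

definition c_meal :: "real \<Rightarrow> real^'n^'m \<Rightarrow> real" where
  "c_meal \<gamma> A = \<gamma>\<^sup>2 * smallest_pos_eigenvalue (transpose A ** A)"

definition alpha_meal :: "real^'n^'m \<Rightarrow> real \<Rightarrow> real \<Rightarrow> real \<Rightarrow> real" where
  "alpha_meal A \<gamma> \<beta> \<eta> = (2 * \<beta> + \<gamma> * \<eta> * (1 - \<eta> / 2)) / (2 * c_meal \<gamma> A * \<beta>\<^sup>2)"

(* To be used for k \<ge> 1 only. *)
definition E_meal ::
  "(real^'n \<Rightarrow> real) \<Rightarrow> real^'n^'m \<Rightarrow> real^'m \<Rightarrow> real \<Rightarrow> real \<Rightarrow> real
    \<Rightarrow> (nat \<Rightarrow> real^'n) \<Rightarrow> (nat \<Rightarrow> real^'n) \<Rightarrow> (nat \<Rightarrow> real^'m) \<Rightarrow> nat \<Rightarrow> real" where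
  "E_meal f A b \<gamma> \<beta> \<alpha> x z l k =
     prox_aug_Lagrangian f A b \<gamma> \<beta> (x k) (z k) (l k) + 2 * \<alpha> * (norm (z k - z (k - 1)))\<^sup>2"

definition P_meal ::
  "(real^'n \<Rightarrow> real) \<Rightarrow> real^'n^'m \<Rightarrow> real^'m \<Rightarrow> real \<Rightarrow> real \<Rightarrow> real
    \<Rightarrow> (real^'n) \<times> (real^'n) \<times> (real^'m) \<times> (real^'n) \<Rightarrow> real" where
  "P_meal f A b \<gamma> \<beta> \<alpha> = (\<lambda>(x, z, l, z').
     prox_aug_Lagrangian f A b \<gamma> \<beta> x z l + 3 * \<alpha> * (norm (z - z'))\<^sup>2)"

end

theory Submission
  imports Defs
begin

text \<open>
  MEAL converges because its potential $P(x, z, \lambda, \hat z)$, evaluated at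
  $y^k = (x^k, z^k, \lambda^k, z^{k-1})$, satisfies the three conditions of the standard
  Kurdyka-Lojasiewicz argument.

  Sufficient descent (\<open>sufficient_descent\<close>): minimizing the strongly convex subproblem and
  averaging into $z$ decrease the proximal augmented Lagrangian, whereas the multiplier step
  increases it by $\|\lambda^{k+1} - \lambda^k\|^2 / \beta$. This increase has to be paid for.
  Optimality of $x^{k+1}$ makes $g^k = - A^T \lambda^{k+1} - (x^{k+1} - z^k) / \gamma$ a
  subgradient of $f$ at $x^{k+1}$, and therefore the gradient of the Moreau envelope at
  $x^{k+1} + \gamma g^k$. The implicit Lipschitz property then bounds $g^{k+1} - g^k$, hence
  $A^T (\lambda^{k+2} - \lambda^{k+1})$, by the primal steps. Feasibility puts the multiplier
  differences into the range of $A$, where $A^T$ is bounded below by the square root of the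
  smallest positive eigenvalue of $A^T A$ (\<open>multiplier_step\<close>). The bound on $\alpha$
  ensures that the primal decrease outweighs this cost; the cost involves the previous step of
  $z$, which is why the potential carries $\|z - \hat z\|^2$.

  Relative error (\<open>relative_error\<close>): replacing $\lambda^k$, $z^k$ by $\lambda^{k+1}$, $z^{k+1}$ in
  the optimality condition leaves an element of the limiting subdifferential of $P$ at $y^{k+1}$
  which is linear in the last steps.

  Continuity: a real-valued weakly convex function on a Euclidean space is continuous, so the
  potential tends to its value at the limit point.

  From here only distances and real sequences matter (locale \<open>KL_descent\<close>). With $h_k$ the gap of the potential
  and $d_k$ the size of the last steps, descent and the KL inequality yield
  $2 d_{k+1} \le d_k + C (h_k^{1-\theta} - h_{k+1}^{1-\theta})$, which telescopes: the trajectory has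
  finite length, stays near the limit point once it is close to it, and its remaining length is
  bounded by a power of $h_k$. The rates come from the recursion
  $\mu h_{k+1}^{2\theta} \le h_k - h_{k+1}$.
\<close>

section \<open>Proximal subgradients and the Moreau envelope\<close>

text \<open>A quadratic lower bound that holds globally. Minimizers of \<open>h\<close> plus a quadratic deliver it
  directly, without any calculus of subdifferentials.\<close>

definition proximal_subgradient :: "real \<Rightarrow> ('a::real_inner \<Rightarrow> real) \<Rightarrow> 'a \<Rightarrow> 'a \<Rightarrow> bool" where
  "proximal_subgradient K h x v \<longleftrightarrow>
     (\<forall>u. h x + v \<bullet> (u - x) - K * (norm (u - x))\<^sup>2 \<le> h u)"

text \<open>The quadratic error term is of smaller order than the distance, so the vector is already a
  Frechet subgradient and constant sequences witness membership in the limiting one.\<close>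

lemma proximal_subgradient_imp_limiting:
  assumes "proximal_subgradient K h x v"
  shows "v \<in> limiting_subdifferential h x"
proof -
  have "0 \<le> Liminf (at x) (\<lambda>u. ereal ((h u - h x - v \<bullet> (u - x)) / norm (x - u)))"
  proof (cases "at x = bot")
    case True
    then show ?thesis by simp
  next
    case False
    have "((\<lambda>u. - K * norm (x - u)) \<longlongrightarrow> - K * norm (x - x)) (at x)"
      by (intro tendsto_intros)
    then have "((\<lambda>u. ereal (- K * norm (x - u))) \<longlongrightarrow> ereal 0) (at x)"
      by (intro tendsto_ereal) simp
    then have "Liminf (at x) (\<lambda>u. ereal (- K * norm (x - u))) = ereal 0"
      using False by (intro lim_imp_Liminf) auto
    moreover have "Liminf (at x) (\<lambda>u. ereal (- K * norm (x - u)))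
        \<le> Liminf (at x) (\<lambda>u. ereal ((h u - h x - v \<bullet> (u - x)) / norm (x - u)))"
    proof (rule Liminf_mono)
      have "- K * norm (x - u) \<le> (h u - h x - v \<bullet> (u - x)) / norm (x - u)" if "u \<noteq> x" for u
      proof -
        have "- K * norm (x - u) * norm (x - u) \<le> h u - h x - v \<bullet> (u - x)"
          using assms[unfolded proximal_subgradient_def, rule_format, of u]
          by (simp add: norm_minus_commute[of x u] power2_eq_square algebra_simps)
        then show ?thesis using that by (simp add: pos_le_divide_eq)
      qed
      then show "\<forall>\<^sub>F u in at x. ereal (- K * norm (x - u))
          \<le> ereal ((h u - h x - v \<bullet> (u - x)) / norm (x - u))"
        by (auto simp: eventually_at_filter)
    qed
    ultimately show ?thesis by (simp add: zero_ereal_def)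
  qed
  then have "v \<in> frechet_subdifferential h x"
    by (simp add: frechet_subdifferential_def)
  then show ?thesis
    unfolding limiting_subdifferential_def
    by (intro CollectI exI[of _ "\<lambda>_. x"] exI[of _ "\<lambda>_. v"]) auto
qed

text \<open>Near \<open>x\<close> the bound is a first-order condition, which weak convexity makes global: apply the
  quadratic bound, whatever its constant, at \<open>x + t (u - x)\<close>, compare it with the chord of the
  convexified function, divide by \<open>t\<close> and let \<open>t\<close> tend to 0; the constant \<open>K\<close> disappears in the
  limit. With \<open>\<rho> / 2\<close> in its place, \<open>\<gamma> < 1 / \<rho>\<close> suffices for quadratic growth of the prox objective.\<close>

lemma weakly_convex_improve_proximal_subgradient:
  assumes wc: "weakly_convex \<rho> h" and sub: "proximal_subgradient K h x v"
  shows "proximal_subgradient (\<rho> / 2) h x v"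
  unfolding proximal_subgradient_def
proof
  fix u
  define s where "s = u - x"
  define n where "n = (norm s)\<^sup>2"
  have n_eq: "n = s \<bullet> s" by (simp add: n_def power2_norm_eq_inner)
  have conv: "convex_on UNIV (\<lambda>x. h x + \<rho> / 2 * (norm x)\<^sup>2)"
    using wc by (simp add: weakly_convex_def)
  \<comment> \<open>The inequality after division by \<open>t\<close>, before the limit.\<close>
  have chord: "v \<bullet> s - \<rho> / 2 * n + t * (\<rho> / 2 - K) * n \<le> h u - h x" if t: "0 < t" "t \<le> 1" for t
  proof -
    have pt: "(1 - t) *\<^sub>R x + t *\<^sub>R u = x + t *\<^sub>R s"
      by (simp add: s_def algebra_simps)
    have "h (x + t *\<^sub>R s) + \<rho> / 2 * (norm (x + t *\<^sub>R s))\<^sup>2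
        \<le> (1 - t) * (h x + \<rho> / 2 * (norm x)\<^sup>2) + t * (h u + \<rho> / 2 * (norm u)\<^sup>2)"
      using convex_onD[OF conv, of t x u] t by (simp add: pt)
    moreover have "(norm (x + t *\<^sub>R s))\<^sup>2 = (norm x)\<^sup>2 + 2 * t * (x \<bullet> s) + t\<^sup>2 * n"
      unfolding n_eq power2_norm_eq_inner power2_eq_square[of t]
      by (simp add: inner_simps inner_commute algebra_simps)
    moreover have "(norm u)\<^sup>2 = (norm x)\<^sup>2 + 2 * (x \<bullet> s) + n"
      by (simp add: n_eq s_def power2_norm_eq_inner inner_simps inner_commute algebra_simps)
    ultimately have "h (x + t *\<^sub>R s) \<le> h x + t * (h u - h x) + \<rho> / 2 * (t - t\<^sup>2) * n"
      by (simp add: field_simps)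
    moreover have "h x + v \<bullet> (t *\<^sub>R s) - K * (norm (t *\<^sub>R s))\<^sup>2 \<le> h (x + t *\<^sub>R s)"
      using sub unfolding proximal_subgradient_def by (metis add_diff_cancel_left')
    ultimately have "t * (v \<bullet> s) - K * t\<^sup>2 * n \<le> t * (h u - h x) + \<rho> / 2 * (t - t\<^sup>2) * n"
      by (simp add: n_def power_mult_distrib)
    then have "t * (v \<bullet> s - \<rho> / 2 * n + t * (\<rho> / 2 - K) * n) \<le> t * (h u - h x)"
      by (simp add: field_simps power2_eq_square)
    then show ?thesis using t by simp
  qed
  have "((\<lambda>t. v \<bullet> s - \<rho> / 2 * n + t * (\<rho> / 2 - K) * n)
      \<longlongrightarrow> v \<bullet> s - \<rho> / 2 * n + 0 * (\<rho> / 2 - K) * n) (at_right 0)"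
    by (intro tendsto_intros)
  moreover have "\<forall>\<^sub>F t in at_right 0. v \<bullet> s - \<rho> / 2 * n + t * (\<rho> / 2 - K) * n \<le> h u - h x"
    unfolding eventually_at_right_field
    using chord by (intro exI[of _ 1]) auto
  ultimately have "v \<bullet> s - \<rho> / 2 * n + 0 * (\<rho> / 2 - K) * n \<le> h u - h x"
    by (rule tendsto_upperbound) simp
  then show "h x + v \<bullet> (u - x) - \<rho> / 2 * (norm (u - x))\<^sup>2 \<le> h u"
    by (simp add: s_def n_def)
qed

text \<open>The slope term vanishes for \<open>w = x + \<gamma> v\<close>. Other values of \<open>w\<close> are needed to differentiate the
  Moreau envelope, where \<open>w\<close> moves while \<open>x\<close> and \<open>v\<close> stay fixed.\<close>

lemma proximal_subgradient_imp_prox_objective_growth: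
  assumes sub: "proximal_subgradient (\<rho> / 2) h x v" and "0 < \<gamma>"
  shows "h x + 1 / (2 * \<gamma>) * (norm (x - w))\<^sup>2 + (v - (1 / \<gamma>) *\<^sub>R (w - x)) \<bullet> (u - x)
           + (1 / \<gamma> - \<rho>) / 2 * (norm (u - x))\<^sup>2
         \<le> h u + 1 / (2 * \<gamma>) * (norm (u - w))\<^sup>2"
proof -
  have u: "u - w = (x - w) + (u - x)" by simp
  have "(norm (u - w))\<^sup>2 = (norm (x - w))\<^sup>2 - 2 * ((w - x) \<bullet> (u - x)) + (norm (u - x))\<^sup>2"
    unfolding u power2_norm_eq_inner by (simp add: inner_simps inner_commute)
  then have "1 / (2 * \<gamma>) * (norm (u - w))\<^sup>2
      = 1 / (2 * \<gamma>) * (norm (x - w))\<^sup>2 - (1 / \<gamma>) * ((w - x) \<bullet> (u - x)) + 1 / (2 * \<gamma>) * (norm (u - x))\<^sup>2"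
    using assms(2) by (simp add: field_simps)
  moreover have "h x + v \<bullet> (u - x) - \<rho> / 2 * (norm (u - x))\<^sup>2 \<le> h u"
    using sub by (simp add: proximal_subgradient_def)
  ultimately show ?thesis
    by (simp add: inner_diff_left diff_divide_distrib algebra_simps)
qed

text \<open>The prox objective at \<open>x + \<gamma> v\<close> grows quadratically away from \<open>x\<close>, so \<open>x\<close> is its only
  minimizer and the choice made by \<^const>\<open>arg_min\<close> is forced.\<close>

lemma prox_eqI:
  assumes sub: "proximal_subgradient (\<rho> / 2) h x v" and \<gamma>: "0 < \<gamma>" "\<gamma> * \<rho> < 1"
  shows "prox \<gamma> h (x + \<gamma> *\<^sub>R v) = x"
proof -
  have pos: "0 < (1 / \<gamma> - \<rho>) / 2" using \<gamma> by (simp add: field_simps)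
  have growth: "h x + 1 / (2 * \<gamma>) * (norm (x - (x + \<gamma> *\<^sub>R v)))\<^sup>2 + (1 / \<gamma> - \<rho>) / 2 * (norm (u - x))\<^sup>2
      \<le> h u + 1 / (2 * \<gamma>) * (norm (u - (x + \<gamma> *\<^sub>R v)))\<^sup>2" for u
    using proximal_subgradient_imp_prox_objective_growth[OF sub \<gamma>(1), of "x + \<gamma> *\<^sub>R v" u] \<gamma> by simp
  have strict: "h x + 1 / (2 * \<gamma>) * (norm (x - (x + \<gamma> *\<^sub>R v)))\<^sup>2
      < h u + 1 / (2 * \<gamma>) * (norm (u - (x + \<gamma> *\<^sub>R v)))\<^sup>2" if "u \<noteq> x" for u
  proof -
    have "0 < (1 / \<gamma> - \<rho>) / 2 * (norm (u - x))\<^sup>2" using pos that by (intro mult_pos_pos) auto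
    then show ?thesis using growth[of u] by linarith
  qed
  have unique: "is_arg_min (\<lambda>u. h u + 1 / (2 * \<gamma>) * (norm (u - (x + \<gamma> *\<^sub>R v)))\<^sup>2) (\<lambda>_. True) u
      \<longleftrightarrow> u = x" for u
    unfolding is_arg_min_def using strict by (metis less_asym)
  show ?thesis
    unfolding prox_def arg_min_def unique by simp
qed

lemma gradient_eqI:
  assumes "GDERIV h x :> g"
  shows "gradient h x = g"
  unfolding gradient_def
proof (rule the_equality)
  fix g' assume "GDERIV h x :> g'"
  with assms have "(\<lambda>s. s \<bullet> g') = (\<lambda>s. s \<bullet> g)"
    unfolding gderiv_def using has_derivative_unique by blast
  then show "g' = g" by (metis inner_commute vector_eq_rdot)
qed (fact assms)

lemma GDERIV_from_quadratic_bound: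
  fixes h :: "'a::real_inner \<Rightarrow> real"
  assumes "\<And>s. \<bar>h (w + s) - h w - g \<bullet> s\<bar> \<le> K * (norm s)\<^sup>2"
  shows "GDERIV h w :> g"
  unfolding gderiv_def has_derivative_at
proof (intro conjI)
  show "bounded_linear (\<lambda>s. s \<bullet> g)" by (rule bounded_linear_inner_left)
  have lim: "((\<lambda>s::'a. K * norm s) \<longlongrightarrow> 0) (at 0)"
    by (intro tendsto_mult_right_zero tendsto_norm_zero tendsto_ident_at)
  have "norm (norm (h (w + s) - h w - s \<bullet> g) / norm s) \<le> K * norm s" if "s \<noteq> 0" for s
    using assms[of s] that
    by (simp add: pos_divide_le_eq power2_eq_square inner_commute mult.assoc)
  then show "(\<lambda>s. norm (h (w + s) - h w - s \<bullet> g) / norm s) \<midarrow>0\<rightarrow> 0"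
    by (intro Lim_null_comparison[OF _ lim]) (auto simp: eventually_at_filter)
qed

text \<open>The envelope is squeezed between two quadratics with the same slope \<open>v\<close>. Testing the infimum at
  \<open>x\<close> gives the upper one; minimizing the growth bound for the prox objective over all \<open>u\<close> gives the
  lower one.\<close>

lemma gradient_moreau_envelope:
  assumes sub: "proximal_subgradient (\<rho> / 2) h x v" and \<gamma>: "0 < \<gamma>" "\<gamma> * \<rho> < 1"
  shows "gradient (moreau_envelope \<gamma> h) (x + \<gamma> *\<^sub>R v) = v"
proof (rule gradient_eqI, rule GDERIV_from_quadratic_bound)
  define w where "w = x + \<gamma> *\<^sub>R v"
  define \<kappa> where "\<kappa> = 1 / \<gamma> - \<rho>"
  define K where "K = 1 / (2 * \<gamma>) + 1 / (2 * \<gamma>\<^sup>2 * \<kappa>)"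
  have \<kappa>: "0 < \<kappa>" using \<gamma> by (simp add: \<kappa>_def field_simps)
  define m where "m = h x + 1 / (2 * \<gamma>) * (norm (x - w))\<^sup>2"
  have base: "h x + 1 / (2 * \<gamma>) * (norm (x - (w + s)))\<^sup>2 = m + v \<bullet> s + 1 / (2 * \<gamma>) * (norm s)\<^sup>2" for s
  proof -
    have e: "x - (w + s) = - (\<gamma> *\<^sub>R v + s)" "x - w = - (\<gamma> *\<^sub>R v)" by (simp_all add: w_def)
    have "(norm (x - (w + s)))\<^sup>2 = (norm (x - w))\<^sup>2 + 2 * \<gamma> * (v \<bullet> s) + (norm s)\<^sup>2"
      unfolding e norm_minus_cancel power2_norm_eq_inner by (simp add: inner_simps inner_commute)
    then show ?thesis unfolding m_def using \<gamma> by (simp add: field_simps)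
  qed
  have lower: "m + v \<bullet> s - K * (norm s)\<^sup>2 \<le> h u + 1 / (2 * \<gamma>) * (norm (u - (w + s)))\<^sup>2" for s u
  proof -
    have "(v - (1 / \<gamma>) *\<^sub>R (w + s - x)) = - ((1 / \<gamma>) *\<^sub>R s)"
      using \<gamma> by (simp add: w_def scaleR_add_right)
    then have "m + v \<bullet> s + 1 / (2 * \<gamma>) * (norm s)\<^sup>2 - (1 / \<gamma>) * (s \<bullet> (u - x)) + \<kappa> / 2 * (norm (u - x))\<^sup>2
        \<le> h u + 1 / (2 * \<gamma>) * (norm (u - (w + s)))\<^sup>2"
      using proximal_subgradient_imp_prox_objective_growth[OF sub \<gamma>(1), of "w + s" u] base[of s]
      by (simp add: \<kappa>_def)
    \<comment> \<open>Completing the square removes \<open>u\<close> from the bound.\<close>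
    moreover have "(1 / \<gamma>) * (s \<bullet> (u - x)) \<le> \<kappa> / 2 * (norm (u - x))\<^sup>2 + 1 / (2 * \<gamma>\<^sup>2 * \<kappa>) * (norm s)\<^sup>2"
    proof -
      have square: "(norm (e - c *\<^sub>R s))\<^sup>2 = (norm e)\<^sup>2 - 2 * c * (s \<bullet> e) + c\<^sup>2 * (norm s)\<^sup>2"
        for e :: 'a and c
        unfolding power2_norm_eq_inner power2_eq_square[of c]
        by (simp add: inner_simps inner_commute algebra_simps)
      have "0 \<le> (norm ((u - x) - (1 / (\<gamma> * \<kappa>)) *\<^sub>R s))\<^sup>2" by simp
      also have "\<dots> = (norm (u - x))\<^sup>2 - 2 / (\<gamma> * \<kappa>) * (s \<bullet> (u - x)) + (1 / (\<gamma> * \<kappa>))\<^sup>2 * (norm s)\<^sup>2"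
        unfolding square by simp
      finally have "0 \<le> \<kappa> / 2 * ((norm (u - x))\<^sup>2 - 2 / (\<gamma> * \<kappa>) * (s \<bullet> (u - x)) + (1 / (\<gamma> * \<kappa>))\<^sup>2 * (norm s)\<^sup>2)"
        using \<kappa> by simp
      also have "\<dots> = \<kappa> / 2 * (norm (u - x))\<^sup>2 - (1 / \<gamma>) * (s \<bullet> (u - x)) + 1 / (2 * \<gamma>\<^sup>2 * \<kappa>) * (norm s)\<^sup>2"
        using \<kappa> \<gamma> by (simp add: field_simps power2_eq_square)
      finally show ?thesis by simp
    qed
    moreover have "1 / (2 * \<gamma>\<^sup>2 * \<kappa>) * (norm s)\<^sup>2 \<le> 1 / (2 * \<gamma>) * (norm s)\<^sup>2 + K * (norm s)\<^sup>2"
      using \<gamma> by (simp add: K_def distrib_right)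
    ultimately show ?thesis by linarith
  qed
  have env_le: "moreau_envelope \<gamma> h (w + s) \<le> m + v \<bullet> s + 1 / (2 * \<gamma>) * (norm s)\<^sup>2" for s
    unfolding moreau_envelope_def base[symmetric]
    by (intro cINF_lower bdd_belowI2[where m = "m + v \<bullet> s - K * (norm s)\<^sup>2"] lower UNIV_I)
  have le_env: "m + v \<bullet> s - K * (norm s)\<^sup>2 \<le> moreau_envelope \<gamma> h (w + s)" for s
    unfolding moreau_envelope_def by (intro cINF_greatest lower) simp
  have env_w: "moreau_envelope \<gamma> h w = m" using env_le[of 0] le_env[of 0] by simp
  have K: "1 / (2 * \<gamma>) * (norm s)\<^sup>2 \<le> K * (norm s)\<^sup>2" for s :: 'a
    using \<kappa> by (intro mult_right_mono) (auto simp: K_def)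
  show "\<bar>moreau_envelope \<gamma> h (x + \<gamma> *\<^sub>R v + s) - moreau_envelope \<gamma> h (x + \<gamma> *\<^sub>R v) - v \<bullet> s\<bar>
      \<le> K * (norm s)\<^sup>2" for s
    unfolding w_def[symmetric] env_w abs_le_iff using env_le[of s] le_env[of s] K[of s]
    by (intro conjI) linarith+
qed

section \<open>The spectral gap of a Gram matrix\<close>

lemma matrix_transpose_inner:
  fixes A :: "real^'n^'m"
  shows "(transpose A *v w) \<bullet> u = w \<bullet> (A *v u)"
  unfolding transpose_matrix_vector by (rule dot_lmul_matrix)

text \<open>Let \<open>\<mu>\<close> be the minimum of the Rayleigh quotient of \<open>A\<^sup>T A\<close> on the range \<open>V\<close> of \<open>A\<^sup>T\<close>.
  The minimizer is an eigenvector because \<open>A\<^sup>T A\<close> maps \<open>V\<close> into itself, and every eigenvector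
  with a positive eigenvalue lies in \<open>V\<close>; so \<open>\<mu>\<close> is the least positive eigenvalue, and in
  particular the least one exists. On the range of \<open>A\<close> the bound for \<open>A\<close> on \<open>V\<close> dualizes to a bound
  for \<open>A\<^sup>T\<close>, since a point \<open>A u\<close> has a preimage in \<open>V\<close>, the orthogonal complement of the kernel.\<close>

lemma smallest_pos_eigenvalue_gram:
  fixes A :: "real^'n^'m"
  assumes "A \<noteq> 0"
  shows "0 < smallest_pos_eigenvalue (transpose A ** A)"
    and "smallest_pos_eigenvalue (transpose A ** A) * (norm (A *v u))\<^sup>2
           \<le> (norm (transpose A *v (A *v u)))\<^sup>2"
proof -
  define T where "T = transpose A"
  define V where "V = range (\<lambda>w. T *v w)"
  have T: "(T *v w) \<bullet> u = w \<bullet> (A *v u)" for w u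
    unfolding T_def by (rule matrix_transpose_inner)
  have gram: "(transpose A ** A) *v v = T *v (A *v v)" for v
    by (simp add: T_def matrix_vector_mul_assoc)
  have sub: "subspace V"
    unfolding V_def by (intro linear_subspace_image matrix_vector_mul_linear subspace_UNIV)
  obtain u0 where "A *v u0 \<noteq> 0"
    using assms by (metis matrix_eq matrix_vector_mult_0)
  then have "T *v (A *v u0) \<noteq> 0"
    using T[of "A *v u0" u0] by auto
  then have "(1 / norm (T *v (A *v u0))) *\<^sub>R (T *v (A *v u0)) \<in> V \<inter> sphere 0 1"
    using subspace_scale[OF sub] by (auto simp: V_def)
  then have ne: "V \<inter> sphere 0 1 \<noteq> {}" by blast
  have "compact (V \<inter> sphere 0 1)"
    using closed_subspace[OF sub] by (simp add: closed_Int_compact)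
  moreover have "continuous_on (V \<inter> sphere 0 1) (\<lambda>v. (norm (A *v v))\<^sup>2)"
    by (intro continuous_intros linear_continuous_on matrix_vector_mul_bounded_linear)
  ultimately obtain p where p: "p \<in> V" "norm p = 1"
    and p_min: "\<And>v. v \<in> V \<Longrightarrow> norm v = 1 \<Longrightarrow> (norm (A *v p))\<^sup>2 \<le> (norm (A *v v))\<^sup>2"
    using continuous_attains_inf[OF _ ne] by (metis (no_types, lifting) IntE IntI mem_sphere_0)
  define \<mu> where "\<mu> = (norm (A *v p))\<^sup>2"
  have rayleigh: "\<mu> * (norm v)\<^sup>2 \<le> (norm (A *v v))\<^sup>2" if "v \<in> V" for v
  proof (cases "v = 0")
    case False
    then have "\<mu> \<le> (norm (A *v ((1 / norm v) *\<^sub>R v)))\<^sup>2"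
      unfolding \<mu>_def using that by (intro p_min subspace_scale[OF sub]) auto
    then show ?thesis
      using False by (simp add: matrix_vector_mult_scaleR power_divide field_simps)
  qed auto
  obtain q where q: "p = T *v q" using p by (auto simp: V_def)
  have "A *v p \<noteq> 0" using T[of q p] p q by auto
  then have \<mu>: "0 < \<mu>" by (simp add: \<mu>_def)
  \<comment> \<open>The derivative of the Rayleigh quotient at \<open>p\<close> in direction \<open>v\<close> vanishes.\<close>
  have stationary: "(A *v p) \<bullet> (A *v v) - \<mu> * (p \<bullet> v) = 0" if "v \<in> V" for v
  proof -
    define c where "c = (A *v p) \<bullet> (A *v v) - \<mu> * (p \<bullet> v)"
    define e where "e = (norm (A *v v))\<^sup>2 - \<mu> * (norm v)\<^sup>2"
    have e: "0 \<le> e" using rayleigh[OF that] by (simp add: e_def)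
    have "0 \<le> 2 * t * c + t\<^sup>2 * e" for t
    proof -
      have "\<mu> * (norm (p + t *\<^sub>R v))\<^sup>2 \<le> (norm (A *v (p + t *\<^sub>R v)))\<^sup>2"
        using p that by (intro rayleigh subspace_add subspace_scale sub)
      moreover have "(norm (p + t *\<^sub>R v))\<^sup>2 = 1 + 2 * t * (p \<bullet> v) + t\<^sup>2 * (norm v)\<^sup>2"
        using p(2) unfolding norm_eq_1 power2_norm_eq_inner power2_eq_square[of t]
        by (simp add: inner_simps inner_commute algebra_simps)
      moreover have "(norm (A *v (p + t *\<^sub>R v)))\<^sup>2
          = \<mu> + 2 * t * ((A *v p) \<bullet> (A *v v)) + t\<^sup>2 * (norm (A *v v))\<^sup>2"
        unfolding \<mu>_def power2_norm_eq_inner power2_eq_square[of t]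
        by (simp add: matrix_vector_right_distrib matrix_vector_mult_scaleR
            inner_simps inner_commute algebra_simps)
      ultimately show ?thesis by (simp add: c_def e_def algebra_simps)
    qed
    \<comment> \<open>The minimum over \<open>t\<close> is near \<open>- c / e\<close>; the shift by 1 avoids a division by 0.\<close>
    from this[of "- c / (e + 1)"] have "0 \<le> 2 * (- c / (e + 1)) * c + (- c / (e + 1))\<^sup>2 * e" .
    also have "\<dots> = - c\<^sup>2 * (e + 2) / (e + 1)\<^sup>2"
      using e by (simp add: divide_simps) (simp add: algebra_simps power2_eq_square)
    finally have "0 * (e + 1)\<^sup>2 \<le> - c\<^sup>2 * (e + 2)"
      using e by (subst (asm) pos_le_divide_eq) auto
    then have "c\<^sup>2 * (e + 2) \<le> 0" by simp
    then have "c\<^sup>2 \<le> 0" using e by (simp add: mult_le_0_iff)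
    then show ?thesis by (simp add: c_def)
  qed
  have "T *v (A *v p) - \<mu> *\<^sub>R p \<in> V"
    using p by (intro subspace_diff subspace_scale sub) (auto simp: V_def)
  from stationary[OF this] have "(T *v (A *v p) - \<mu> *\<^sub>R p) \<bullet> (T *v (A *v p) - \<mu> *\<^sub>R p) = 0"
    by (simp add: T inner_diff_left)
  then have eig: "(transpose A ** A) *v p = \<mu> *\<^sub>R p" by (simp add: gram)
  have least: "smallest_pos_eigenvalue (transpose A ** A) = \<mu>"
    unfolding smallest_pos_eigenvalue_def
  proof (rule Least_equality)
    show "0 < \<mu> \<and> (\<exists>v. v \<noteq> 0 \<and> (transpose A ** A) *v v = \<mu> *\<^sub>R v)"
      using \<mu> eig p by (metis norm_zero zero_neq_one)
  next
    fix \<mu>' assume "0 < \<mu>' \<and> (\<exists>v. v \<noteq> 0 \<and> (transpose A ** A) *v v = \<mu>' *\<^sub>R v)"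
    then obtain v where v: "0 < \<mu>'" "v \<noteq> 0" "T *v (A *v v) = \<mu>' *\<^sub>R v" by (auto simp: gram)
    have "(1 / \<mu>') *\<^sub>R (T *v (A *v v)) \<in> V"
      by (intro subspace_scale sub) (auto simp: V_def)
    then have "v \<in> V" using v by simp
    then have "\<mu> * (norm v)\<^sup>2 \<le> (norm (A *v v))\<^sup>2" by (rule rayleigh)
    also have "\<dots> = \<mu>' * (norm v)\<^sup>2"
      using T[of "A *v v" v] v by (simp add: power2_norm_eq_inner)
    finally show "\<mu> \<le> \<mu>'" using v by simp
  qed
  show "0 < smallest_pos_eigenvalue (transpose A ** A)" by (simp add: least \<mu>)
  obtain u1 u2 where u: "u = u1 + u2" "u1 \<in> V" "\<And>v. v \<in> V \<Longrightarrow> orthogonal u2 v"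
    using orthogonal_subspace_decomp_exists[of V u] span_eq_iff[THEN iffD2, OF sub] by metis
  have "T *v (A *v u2) \<in> V" by (auto simp: V_def)
  then have "A *v u2 = 0"
    using u(3)[of "T *v (A *v u2)"] T[of "A *v u2" u2] by (simp add: orthogonal_def inner_commute)
  then have Au: "A *v u = A *v u1" by (simp add: u matrix_vector_right_distrib)
  have "(norm (A *v u))\<^sup>2 = u1 \<bullet> (T *v (A *v u))"
    using T[of "A *v u" u1] by (simp add: Au power2_norm_eq_inner inner_commute)
  also have "\<dots> \<le> norm u1 * norm (T *v (A *v u))" by (rule norm_cauchy_schwarz)
  finally have "((norm (A *v u))\<^sup>2)\<^sup>2 \<le> (norm u1 * norm (T *v (A *v u)))\<^sup>2"
    by (intro power_mono) auto
  then have "\<mu> * ((norm (A *v u))\<^sup>2)\<^sup>2 \<le> (\<mu> * (norm u1)\<^sup>2) * (norm (T *v (A *v u)))\<^sup>2"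
    using \<mu> by (simp add: power_mult_distrib)
  also have "\<dots> \<le> (norm (A *v u))\<^sup>2 * (norm (T *v (A *v u)))\<^sup>2"
    unfolding Au by (intro mult_right_mono rayleigh u) auto
  finally have "(norm (A *v u))\<^sup>2 * (\<mu> * (norm (A *v u))\<^sup>2)
      \<le> (norm (A *v u))\<^sup>2 * (norm (T *v (A *v u)))\<^sup>2"
    by (simp add: power2_eq_square algebra_simps)
  then have "\<mu> * (norm (A *v u))\<^sup>2 \<le> (norm (T *v (A *v u)))\<^sup>2"
    by (cases "A *v u = 0") (auto simp: mult_le_cancel_left)
  then show "smallest_pos_eigenvalue (transpose A ** A) * (norm (A *v u))\<^sup>2
      \<le> (norm (transpose A *v (A *v u)))\<^sup>2"
    by (simp add: least T_def)
qed

section \<open>Descent sequences under a Kurdyka-Lojasiewicz inequality\<close>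

text \<open>Concavity of \<open>s powr q\<close>; allowing \<open>t = 0\<close> covers a potential that reaches its limit value.\<close>

lemma powr_tangent_upper:
  fixes s t q :: real
  assumes "0 < s" "0 \<le> t" "0 < q" "q \<le> 1"
  shows "q * s powr (q - 1) * (s - t) \<le> s powr q - t powr q"
proof (cases "t = 0")
  case True
  have "s powr (q - 1) * s = s powr q"
    using assms by (simp add: powr_diff)
  then have "q * s powr (q - 1) * (s - t) = q * s powr q" using True by (simp add: mult.assoc)
  also have "\<dots> \<le> 1 * s powr q" using assms by (intro mult_right_mono) auto
  finally show ?thesis using True by simp
next
  case False
  define w where "w = s powr (q - 1)"
  have sw: "s * w = s powr q" using assms by (simp add: w_def powr_diff)
  have cancel: "s powr (1 - q) * w = 1"
    using assms by (simp add: w_def powr_add[symmetric])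
  have "t powr q * s powr (1 - q) \<le> q * t + (1 - q) * s"
    using assms False by (intro Youngs_inequality_0) auto
  then have "t powr q * s powr (1 - q) * w \<le> (q * t + (1 - q) * s) * w"
    by (rule mult_right_mono) (simp add: w_def)
  then have "t powr q \<le> q * t * w + (1 - q) * (s * w)"
    by (simp only: mult.assoc cancel mult_1_right distrib_right)
  then have "q * w * (s - t) \<le> s * w - t powr q"
    by (simp add: algebra_simps)
  then show ?thesis unfolding sw by (simp add: w_def)
qed

text \<open>Convexity of \<open>s powr (- p)\<close>, read off from \<open>exp u \<ge> 1 + u\<close> and \<open>ln u \<le> u - 1\<close>.\<close>

lemma powr_tangent_lower:
  fixes s t p :: real
  assumes "0 < s" "0 < t" "0 \<le> p"
  shows "p * s powr (- p - 1) * (s - t) \<le> t powr (- p) - s powr (- p)"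
proof -
  have "1 + (- p) * ln (t / s) \<le> exp ((- p) * ln (t / s))" by (rule exp_ge_add_one_self)
  also have "\<dots> = (t / s) powr (- p)" using assms by (simp add: powr_def)
  also have "\<dots> = t powr (- p) / s powr (- p)" using assms by (simp add: powr_divide)
  finally have "1 + (- p) * ln (t / s) \<le> t powr (- p) / s powr (- p)" .
  moreover have "p * ln (t / s) \<le> p * (t / s - 1)"
    using assms by (intro mult_left_mono ln_le_minus_one) auto
  ultimately have "p * (1 - t / s) \<le> t powr (- p) / s powr (- p) - 1" by (simp add: algebra_simps)
  then have "p * (1 - t / s) * s powr (- p) \<le> (t powr (- p) / s powr (- p) - 1) * s powr (- p)"
    by (rule mult_right_mono) simp
  moreover have "p * (1 - t / s) * s powr (- p) = p * s powr (- p - 1) * (s - t)"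
    using assms by (simp add: powr_diff field_simps)
  moreover have "(t powr (- p) / s powr (- p) - 1) * s powr (- p) = t powr (- p) - s powr (- p)"
    using assms by (simp add: left_diff_distrib)
  ultimately show ?thesis by simp
qed

text \<open>The core of the KL method. Concavity of \<open>s powr (1 - \<theta>)\<close> bounds the decrease of the
  desingularised gap from below by its slope times \<open>a d'\<^sup>2\<close>, and the KL inequality bounds the slope
  from below by a multiple of \<open>1 / d\<close>; thus \<open>d'\<^sup>2 / d\<close> is controlled by a telescoping term, and the
  arithmetic-geometric mean inequality makes this linear. For \<open>s = 0\<close> the descent alone forces
  \<open>d' = 0\<close>, so no case distinction on termination is needed later.\<close>

lemma desingularised_descent:
  fixes s t :: real
  assumes a: "0 < a" and M: "0 < M" and \<theta>: "0 \<le> \<theta>" "\<theta> < 1"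
    and st: "0 \<le> s" "0 \<le> t" and d: "0 \<le> d" "0 \<le> d'"
    and desc: "t + a * d'\<^sup>2 \<le> s"
    and KL: "0 < s \<Longrightarrow> 1 \<le> M * (1 - \<theta>) * s powr (- \<theta>) * d"
  shows "2 * d' \<le> d + M / a * (s powr (1 - \<theta>) - t powr (1 - \<theta>))"
proof (cases "s = 0")
  case True
  have "0 \<le> a * d'\<^sup>2" using a by simp
  then have "a * d'\<^sup>2 = 0" "t = 0"
    using desc True st by linarith+
  then show ?thesis using True a d by simp
next
  case False
  then have s: "0 < s" using st by simp
  define \<Delta> where "\<Delta> = s powr (1 - \<theta>) - t powr (1 - \<theta>)"
  have "(1 - \<theta>) * s powr (- \<theta>) * (a * d'\<^sup>2) \<le> (1 - \<theta>) * s powr (1 - \<theta> - 1) * (s - t)"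
    using desc \<theta> a by (intro mult_mono) auto
  also have "\<dots> \<le> \<Delta>"
    unfolding \<Delta>_def using s st \<theta> by (intro powr_tangent_upper) auto
  finally have \<Delta>: "(1 - \<theta>) * s powr (- \<theta>) * (a * d'\<^sup>2) \<le> \<Delta>" .
  moreover have "0 \<le> (1 - \<theta>) * s powr (- \<theta>) * (a * d'\<^sup>2)" using \<theta> a by simp
  ultimately have \<Delta>0: "0 \<le> \<Delta>" by linarith
  have "a * d'\<^sup>2 * 1 \<le> a * d'\<^sup>2 * (M * (1 - \<theta>) * s powr (- \<theta>) * d)"
    using KL[OF s] a by (intro mult_left_mono) auto
  also have "\<dots> = M * d * ((1 - \<theta>) * s powr (- \<theta>) * (a * d'\<^sup>2))" by (simp add: algebra_simps)
  also have "\<dots> \<le> M * d * \<Delta>" using \<Delta> M d by (intro mult_left_mono) auto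
  finally have "d'\<^sup>2 \<le> d * (M / a * \<Delta>)" using a by (simp add: field_simps)
  also have "d * e \<le> ((d + e) / 2)\<^sup>2" for e
    using zero_le_power2[of "d - e"] by (simp add: power2_eq_square field_simps)
  finally have "d' \<le> (d + M / a * \<Delta>) / 2"
    by (rule power2_le_imp_le) (use d \<Delta>0 M a in auto)
  then show ?thesis by (simp add: \<Delta>_def)
qed

lemma descent_steps_tendsto_zero:
  fixes h d :: "nat \<Rightarrow> real"
  assumes a: "0 < a" and conv: "convergent h"
    and desc: "\<And>k. N \<le> k \<Longrightarrow> h (Suc k) + a * (d (Suc k))\<^sup>2 \<le> h k"
  shows "d \<longlonglongrightarrow> 0"
proof -
  obtain c where c: "h \<longlonglongrightarrow> c" using conv by (auto simp: convergent_def)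
  have "(\<lambda>k. (h k - h (Suc k)) / a) \<longlonglongrightarrow> (c - c) / a"
    using a by (intro tendsto_intros c LIMSEQ_Suc) auto
  then have lim: "(\<lambda>k. (h k - h (Suc k)) / a) \<longlonglongrightarrow> 0" by simp
  have "norm ((d (Suc k))\<^sup>2) \<le> (h k - h (Suc k)) / a" if "N \<le> k" for k
    using desc[OF that] a by (simp add: field_simps)
  then have "(\<lambda>k. (d (Suc k))\<^sup>2) \<longlonglongrightarrow> 0"
    by (intro Lim_null_comparison[OF _ lim] eventually_sequentiallyI)
  then have "(\<lambda>k. sqrt ((d (Suc k))\<^sup>2)) \<longlonglongrightarrow> sqrt 0" by (rule tendsto_real_sqrt)
  then have "(\<lambda>k. d (Suc k)) \<longlonglongrightarrow> 0" by (simp add: tendsto_rabs_zero_iff)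
  then show ?thesis by (rule LIMSEQ_imp_Suc)
qed

text \<open>The data of a descent method: \<open>h k\<close> is the gap between the potential at \<open>y k\<close> and at \<open>ystar\<close>,
  \<open>d k\<close> measures the last step. \<open>KL_bound\<close> is the KL inequality after the distance from 0 to the
  subdifferential has been replaced by a multiple of \<open>d k\<close>; it is available near \<open>ystar\<close> only,
  and \<open>ystar\<close> is at first merely a cluster point.\<close>

locale KL_descent =
  fixes y :: "nat \<Rightarrow> 'a::metric_space" and ystar :: 'a
    and h d :: "nat \<Rightarrow> real" and \<theta> a M D r \<nu> :: real and N :: nat
  assumes pos: "0 < a" "0 < M" "0 < D" "0 < r" "0 < \<nu>"
    and \<theta>: "0 \<le> \<theta>" "\<theta> < 1"
    and d_nonneg: "\<And>k. 0 \<le> d k"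
    and descent: "\<And>k. N \<le> k \<Longrightarrow> h (Suc k) + a * (d (Suc k))\<^sup>2 \<le> h k"
    and h_tendsto: "h \<longlonglongrightarrow> 0"
    and dist_step: "\<And>k. N \<le> k \<Longrightarrow> dist (y (Suc k)) (y k) \<le> D * d (Suc k)"
    and KL_bound: "\<And>k. N \<le> k \<Longrightarrow> dist (y k) ystar < r \<Longrightarrow> 0 < h k \<Longrightarrow> h k < \<nu> \<Longrightarrow>
            1 \<le> M * (1 - \<theta>) * h k powr (- \<theta>) * d k"
    and cluster: "\<exists>s. strict_mono s \<and> (\<lambda>k. y (s k)) \<longlonglongrightarrow> ystar"
begin

lemma h_Suc_le:
  assumes "N \<le> k"
  shows "h (Suc k) \<le> h k"
proof -
  have "0 \<le> a * (d (Suc k))\<^sup>2" using pos by simp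
  then show ?thesis using descent[OF assms] by linarith
qed

lemma h_antimono:
  assumes "N \<le> j" "j \<le> k"
  shows "h k \<le> h j"
  using assms(2)
proof (induction k rule: dec_induct)
  case (step k)
  then show ?case using h_Suc_le[of k] assms(1) by linarith
qed simp

lemma h_nonneg: "N \<le> k \<Longrightarrow> 0 \<le> h k"
  by (rule LIMSEQ_le_const2[OF h_tendsto]) (use h_antimono in blast)

lemma d_tendsto: "d \<longlonglongrightarrow> 0"
  by (rule descent_steps_tendsto_zero[OF pos(1) convergentI[OF h_tendsto], of N]) (rule descent)

text \<open>An upper bound for the length of the trajectory after time \<open>k\<close>, as long as the KL inequality
  remains in force.\<close>

definition budget :: "nat \<Rightarrow> real" where
  "budget k = d k + M / a * h k powr (1 - \<theta>)"

lemma budget_tendsto: "budget \<longlonglongrightarrow> 0"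
proof -
  have "(\<lambda>k. h k powr (1 - \<theta>)) \<longlonglongrightarrow> 0 powr (1 - \<theta>)"
  proof -
    have "\<forall>\<^sub>F k in sequentially. 0 \<le> h k"
      using h_nonneg by (rule eventually_sequentiallyI)
    then show ?thesis
      using tendsto_powr'[OF h_tendsto tendsto_const[of "1 - \<theta>"]] \<theta> by simp
  qed
  then have "(\<lambda>k. d k + M / a * h k powr (1 - \<theta>)) \<longlonglongrightarrow> 0 + M / a * 0 powr (1 - \<theta>)"
    by (intro tendsto_add tendsto_mult tendsto_const d_tendsto)
  then show ?thesis using \<theta> by (simp add: budget_def[abs_def])
qed

text \<open>Summing the desingularised descent telescopes. The induction keeps the last step and the last
  desingularised gap on the left, since this is what makes the sum close up.\<close>

lemma length_le_budget:
  assumes "N \<le> K" and "K \<le> j" and "\<And>i. K \<le> i \<Longrightarrow> i < j \<Longrightarrow> dist (y i) ystar < r \<and> h i < \<nu>"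
  shows "dist (y j) (y K) \<le> D * budget K"
proof -
  have "(\<Sum>i\<in>{K..<j}. d (Suc i)) + d j + M / a * h j powr (1 - \<theta>) \<le> budget K
      \<and> dist (y j) (y K) \<le> D * (\<Sum>i\<in>{K..<j}. d (Suc i))"
    using assms(2,3)
  proof (induction j rule: dec_induct)
    case base
    then show ?case by (simp add: budget_def)
  next
    case (step i)
    have i: "N \<le> i" using step assms by simp
    have sub: "\<And>k. K \<le> k \<Longrightarrow> k < i \<Longrightarrow> dist (y k) ystar < r \<and> h k < \<nu>"
      using step.prems by (meson less_SucI)
    note IH = step.IH[OF sub]
    have "2 * d (Suc i) \<le> d i + M / a * (h i powr (1 - \<theta>) - h (Suc i) powr (1 - \<theta>))"
      using i step pos \<theta> d_nonneg descent[OF i] h_nonneg KL_bound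
      by (intro desingularised_descent) auto
    moreover have "dist (y (Suc i)) (y K) \<le> dist (y (Suc i)) (y i) + dist (y i) (y K)"
      by (rule dist_triangle)
    ultimately show ?case
      using IH step.hyps dist_step[OF i] by (simp add: algebra_simps)
  qed
  moreover have "0 \<le> d j + M / a * h j powr (1 - \<theta>)" using d_nonneg[of j] pos by simp
  ultimately have "(\<Sum>i\<in>{K..<j}. d (Suc i)) \<le> budget K"
    "dist (y j) (y K) \<le> D * (\<Sum>i\<in>{K..<j}. d (Suc i))" by auto
  then show ?thesis
    using pos mult_left_mono[of "\<Sum>i\<in>{K..<j}. d (Suc i)" "budget K" D] by linarith
qed

text \<open>Near the cluster point the remaining budget is smaller than the distance to the boundary of the
  neighbourhood, so the trajectory cannot leave; this is what upgrades the cluster point to a limit.\<close>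

lemma eventually_trapped:
  assumes "0 < \<epsilon>"
  shows "\<exists>K\<ge>N. \<forall>j\<ge>K. dist (y j) ystar < min r \<epsilon> \<and> h j < \<nu>"
proof -
  obtain s where s: "strict_mono s" "(\<lambda>k. y (s k)) \<longlonglongrightarrow> ystar" using cluster by blast
  define \<epsilon>' where "\<epsilon>' = min r \<epsilon>"
  have \<epsilon>': "0 < \<epsilon>'" using assms pos by (simp add: \<epsilon>'_def)
  have near: "\<forall>\<^sub>F k in sequentially. dist (y (s k)) ystar < \<epsilon>' / 2"
    using s(2) \<epsilon>' by (intro tendstoD) auto
  have "(\<lambda>k. D * budget k) \<longlonglongrightarrow> D * 0" by (intro tendsto_intros budget_tendsto)
  then have "\<forall>\<^sub>F k in sequentially. D * budget k < \<epsilon>' / 2"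
    using \<epsilon>' by (intro order_tendstoD) auto
  moreover have "\<forall>\<^sub>F k in sequentially. h k < \<nu>"
    using pos h_tendsto by (intro order_tendstoD) auto
  ultimately have "\<forall>\<^sub>F k in sequentially. N \<le> k \<and> D * budget k < \<epsilon>' / 2 \<and> h k < \<nu>"
    by (intro eventually_conj eventually_ge_at_top)
  then have "\<forall>\<^sub>F k in sequentially. N \<le> s k \<and> D * budget (s k) < \<epsilon>' / 2 \<and> h (s k) < \<nu>"
    using s(1) by (rule eventually_subseq[rotated])
  then obtain k where k: "N \<le> s k" "D * budget (s k) < \<epsilon>' / 2" "h (s k) < \<nu>"
    "dist (y (s k)) ystar < \<epsilon>' / 2"
    using eventually_happens'[OF sequentially_bot eventually_conj[OF _ near]] by blast
  have "dist (y j) ystar < \<epsilon>'" if "s k \<le> j" for j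
    using that
  proof (induction j rule: less_induct)
    case (less j)
    have "dist (y j) (y (s k)) \<le> D * budget (s k)"
    proof (rule length_le_budget[OF k(1) less.prems])
      fix i assume i: "s k \<le> i" "i < j"
      have "dist (y i) ystar < \<epsilon>'" using less.IH i by simp
      moreover have "h i \<le> h (s k)" using i k by (intro h_antimono) auto
      ultimately show "dist (y i) ystar < r \<and> h i < \<nu>" using k by (simp add: \<epsilon>'_def)
    qed
    then show ?case using k dist_triangle[of "y j" ystar "y (s k)"] by linarith
  qed
  moreover have "h j < \<nu>" if "s k \<le> j" for j
    using h_antimono[OF k(1) that] k by simp
  ultimately show ?thesis using k(1) by (auto simp: \<epsilon>'_def intro!: exI[of _ "s k"])
qed

theorem convergence: "y \<longlonglongrightarrow> ystar"
proof (rule tendstoI)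
  fix \<epsilon> :: real assume "0 < \<epsilon>"
  from eventually_trapped[OF this] show "\<forall>\<^sub>F k in sequentially. dist (y k) ystar < \<epsilon>"
    by (auto simp: eventually_sequentially)
qed

lemma asymptotic_regime:
  obtains K where "N \<le> K" "\<And>k. K \<le> k \<Longrightarrow> dist (y k) ystar < r \<and> h k < \<nu> \<and> h k \<le> 1"
    "\<And>k. K \<le> k \<Longrightarrow> dist (y k) ystar \<le> D * budget k"
proof -
  obtain K1 where K1: "N \<le> K1" "\<And>j. K1 \<le> j \<Longrightarrow> dist (y j) ystar < r \<and> h j < \<nu>"
    using eventually_trapped[of 1] by auto
  have "\<forall>\<^sub>F k in sequentially. h k < 1"
    using h_tendsto by (intro order_tendstoD) auto
  then obtain K2 where K2: "\<And>k. K2 \<le> k \<Longrightarrow> h k \<le> 1"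
    by (meson eventually_sequentially less_imp_le)
  have tail: "dist (y k) ystar \<le> D * budget k" if "max K1 K2 \<le> k" for k
  proof (rule LIMSEQ_le_const2)
    show "(\<lambda>j. dist (y k) (y j)) \<longlonglongrightarrow> dist (y k) ystar"
      by (intro tendsto_intros convergence)
    have "dist (y k) (y j) \<le> D * budget k" if "k \<le> j" for j
      unfolding dist_commute[of "y k"] using K1 that \<open>max K1 K2 \<le> k\<close>
      by (intro length_le_budget) auto
    then show "\<exists>n. \<forall>j\<ge>n. dist (y k) (y j) \<le> D * budget k" by blast
  qed
  show thesis
    by (rule that[of "max K1 K2"]) (use K1 K2 tail in auto)
qed

text \<open>For \<open>\<theta> = 0\<close> a positive gap keeps the steps away from 0, which contradicts their convergence to 0.\<close>

theorem finite_termination: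
  assumes "\<theta> = 0"
  shows "\<exists>k\<^sub>0. \<forall>k\<ge>k\<^sub>0. y k = ystar"
proof -
  obtain K where K: "N \<le> K" "\<And>k. K \<le> k \<Longrightarrow> dist (y k) ystar < r \<and> h k < \<nu> \<and> h k \<le> 1"
    "\<And>k. K \<le> k \<Longrightarrow> dist (y k) ystar \<le> D * budget k"
    by (rule asymptotic_regime) blast
  have "\<forall>\<^sub>F k in sequentially. d k < 1 / M"
    using d_tendsto pos by (intro order_tendstoD) auto
  then obtain K' where K': "\<And>k. K' \<le> k \<Longrightarrow> d k < 1 / M" by (auto simp: eventually_sequentially)
  have h0: "h k = 0" if k: "max K K' \<le> k" for k
  proof (rule ccontr)
    assume "h k \<noteq> 0"
    then have "0 < h k" using h_nonneg[of k] K k by simp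
    then have "1 \<le> M * d k" using KL_bound[of k] K k assms by auto
    then show False using K'[of k] k pos by (simp add: field_simps)
  qed
  have "y (Suc k) = ystar" if k: "max K K' \<le> k" for k
  proof -
    have "a * (d (Suc k))\<^sup>2 \<le> 0"
      using descent[of k] h0[of k] h0[of "Suc k"] k K by simp
    then have "d (Suc k) = 0"
      using pos by (simp add: mult_le_0_iff)
    then have "budget (Suc k) = 0" using h0[of "Suc k"] k by (simp add: budget_def)
    then show ?thesis using K(3)[of "Suc k"] k by simp
  qed
  then show ?thesis
    by (intro exI[of _ "Suc (max K K')"]) (metis Suc_le_D Suc_le_mono)
qed

text \<open>The KL inequality bounds \<open>d (Suc k)\<close> from below by a multiple of \<open>h (Suc k) powr \<theta>\<close>; insert this
  into the descent inequality.\<close>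

lemma gap_recursion:
  assumes "N \<le> k" "dist (y (Suc k)) ystar < r" "h (Suc k) < \<nu>"
  shows "a / (M * (1 - \<theta>))\<^sup>2 * h (Suc k) powr (2 * \<theta>) \<le> h k - h (Suc k)"
proof (cases "h (Suc k) = 0")
  case True
  then show ?thesis using h_nonneg assms by simp
next
  case False
  then have hpos: "0 < h (Suc k)" using h_nonneg[of "Suc k"] assms by simp
  have M\<theta>: "0 < M * (1 - \<theta>)" using pos \<theta> by simp
  have "1 * h (Suc k) powr \<theta> \<le> M * (1 - \<theta>) * h (Suc k) powr (- \<theta>) * d (Suc k) * h (Suc k) powr \<theta>"
    using KL_bound[of "Suc k"] hpos assms by (intro mult_right_mono) auto
  also have "\<dots> = M * (1 - \<theta>) * d (Suc k)"
    using hpos by (simp add: powr_minus field_simps)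
  finally have "h (Suc k) powr \<theta> / (M * (1 - \<theta>)) \<le> d (Suc k)"
    using M\<theta> by (simp add: field_simps)
  then have "(h (Suc k) powr \<theta> / (M * (1 - \<theta>)))\<^sup>2 \<le> (d (Suc k))\<^sup>2"
    using M\<theta> by (intro power_mono) auto
  then have "a * (h (Suc k) powr \<theta> / (M * (1 - \<theta>)))\<^sup>2 \<le> a * (d (Suc k))\<^sup>2"
    using pos by simp
  also have "\<dots> \<le> h k - h (Suc k)" using descent[OF assms(1)] by simp
  finally show ?thesis
    by (simp add: power_divide power2_eq_square powr_add[symmetric])
qed

text \<open>Both terms of the budget are powers of the gap, with exponents \<open>1 / 2\<close> (from the descent
  inequality) and \<open>1 - \<theta>\<close>; for gaps below 1 the smaller exponent dominates. All rates for the
  iterates reduce to rates for the gap.\<close>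

lemma distance_le_gap:
  obtains K E where "N \<le> K" "0 < E"
    "\<And>k. K \<le> k \<Longrightarrow> dist (y (Suc k)) ystar \<le> E * h k powr min (1 / 2) (1 - \<theta>)"
    "\<And>k. K \<le> k \<Longrightarrow> a / (M * (1 - \<theta>))\<^sup>2 * h (Suc k) powr (2 * \<theta>) \<le> h k - h (Suc k)"
    "\<And>k. K \<le> k \<Longrightarrow> h k \<le> 1"
proof -
  obtain K where K: "N \<le> K" "\<And>k. K \<le> k \<Longrightarrow> dist (y k) ystar < r \<and> h k < \<nu> \<and> h k \<le> 1"
    "\<And>k. K \<le> k \<Longrightarrow> dist (y k) ystar \<le> D * budget k"
    by (rule asymptotic_regime) blast
  define q where "q = min (1 / 2) (1 - \<theta>)"
  have q: "q \<le> 1 / 2" "q \<le> 1 - \<theta>"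
    unfolding q_def by (rule min.cobounded1, rule min.cobounded2)
  define E where "E = D * (1 / sqrt a + M / a)"
  have E: "0 < E" using pos by (simp add: E_def add_pos_pos)
  have "dist (y (Suc k)) ystar \<le> E * h k powr q" if k: "K \<le> k" for k
  proof -
    have hk: "0 \<le> h k" "h k \<le> 1" "0 \<le> h (Suc k)" "h (Suc k) \<le> h k"
      using h_nonneg K k h_Suc_le by auto
    have lower: "h k powr s \<le> h k powr q" if "q \<le> s" for s
      using hk that by (cases "h k = 0") (auto intro!: powr_mono')
    have "a * (d (Suc k))\<^sup>2 \<le> h k" using descent[of k] hk K k by simp
    then have "(d (Suc k))\<^sup>2 \<le> h k / a" using pos by (simp add: field_simps)
    then have "d (Suc k) \<le> sqrt (h k / a)" by (rule real_le_rsqrt)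
    also have "\<dots> = 1 / sqrt a * h k powr (1 / 2)"
      using hk by (simp add: real_sqrt_divide powr_half_sqrt)
    also have "\<dots> \<le> 1 / sqrt a * h k powr q"
      using pos q(1) by (intro mult_left_mono lower) auto
    finally have "d (Suc k) \<le> 1 / sqrt a * h k powr q" .
    moreover have "M / a * h (Suc k) powr (1 - \<theta>) \<le> M / a * h k powr q"
    proof (rule mult_left_mono)
      have "h (Suc k) powr (1 - \<theta>) \<le> h k powr (1 - \<theta>)"
        using hk \<theta> by (intro powr_mono2) auto
      also have "\<dots> \<le> h k powr q" by (rule lower[OF q(2)])
      finally show "h (Suc k) powr (1 - \<theta>) \<le> h k powr q" .
    qed (use pos in auto)
    ultimately have "budget (Suc k) \<le> (1 / sqrt a + M / a) * h k powr q"
      by (simp add: budget_def algebra_simps)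
    then have "D * budget (Suc k) \<le> D * ((1 / sqrt a + M / a) * h k powr q)"
      using pos by (intro mult_left_mono) auto
    then show ?thesis using K(3)[of "Suc k"] k by (simp add: E_def)
  qed
  moreover have "a / (M * (1 - \<theta>))\<^sup>2 * h (Suc k) powr (2 * \<theta>) \<le> h k - h (Suc k)" if "K \<le> k" for k
    using K that by (intro gap_recursion) auto
  ultimately show thesis using that[OF K(1) E] K(2) unfolding q_def by blast
qed

text \<open>For gaps at most 1 and \<open>2 \<theta> \<le> 1\<close> the recursion implies \<open>\<mu> h (Suc k) \<le> h k - h (Suc k)\<close>, a geometric
  contraction.\<close>

theorem linear_rate:
  assumes "\<theta> \<le> 1 / 2"
  shows "\<exists>k\<^sub>0>0. \<exists>c>0. \<exists>\<tau>. 0 < \<tau> \<and> \<tau> < 1 \<and> (\<forall>k\<ge>k\<^sub>0. dist (y k) ystar \<le> c * \<tau> ^ k)"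
proof -
  obtain K E where K: "N \<le> K" and E: "0 < E"
    and dist: "\<And>k. K \<le> k \<Longrightarrow> dist (y (Suc k)) ystar \<le> E * h k powr min (1 / 2) (1 - \<theta>)"
    and rec: "\<And>k. K \<le> k \<Longrightarrow> a / (M * (1 - \<theta>))\<^sup>2 * h (Suc k) powr (2 * \<theta>) \<le> h k - h (Suc k)"
    and h1: "\<And>k. K \<le> k \<Longrightarrow> h k \<le> 1"
    by (rule distance_le_gap) blast
  define \<mu> where "\<mu> = a / (M * (1 - \<theta>))\<^sup>2"
  have \<mu>: "0 < \<mu>" using pos \<theta> by (simp add: \<mu>_def)
  define \<tau> where "\<tau> = sqrt (1 / (1 + \<mu>))"
  have \<tau>: "0 < \<tau>" "\<tau> < 1" "\<tau>\<^sup>2 = 1 / (1 + \<mu>)" using \<mu> by (auto simp: \<tau>_def)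
  have contract: "h (Suc k) \<le> \<tau>\<^sup>2 * h k" if k: "K \<le> k" for k
  proof -
    have hs: "0 \<le> h (Suc k)" "h (Suc k) \<le> 1" using h_nonneg K k h1 by auto
    have "h (Suc k) \<le> h (Suc k) powr (2 * \<theta>)"
      using powr_mono'[of "2 * \<theta>" 1 "h (Suc k)"] hs assms by simp
    then have "\<mu> * h (Suc k) \<le> \<mu> * h (Suc k) powr (2 * \<theta>)" using \<mu> by simp
    also have "\<dots> \<le> h k - h (Suc k)" using rec[OF k] by (simp add: \<mu>_def)
    finally show ?thesis using \<mu> unfolding \<tau>(3) by (simp add: field_simps)
  qed
  have geom: "h (K + n) \<le> (\<tau> ^ n)\<^sup>2" for n
  proof (induction n)
    case (Suc n)
    have "h (K + Suc n) \<le> \<tau>\<^sup>2 * h (K + n)" using contract[of "K + n"] by simp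
    also have "\<dots> \<le> \<tau>\<^sup>2 * (\<tau> ^ n)\<^sup>2" using Suc by (intro mult_left_mono) auto
    finally show ?case by (simp add: power_mult_distrib)
  qed (use h1 in simp)
  define c where "c = E / \<tau> ^ Suc K"
  have "dist (y k) ystar \<le> c * \<tau> ^ k" if k: "Suc K \<le> k" for k
  proof -
    obtain n where n: "k = Suc (K + n)" using k by (metis add_Suc le_Suc_ex)
    have "h (K + n) powr (1 / 2) = sqrt (h (K + n))"
      using K h_nonneg by (simp add: powr_half_sqrt)
    also have "\<dots> \<le> \<tau> ^ n" using geom[of n] \<tau> by (intro real_le_lsqrt) auto
    finally have "E * h (K + n) powr (1 / 2) \<le> E * \<tau> ^ n" using E by simp
    moreover have "dist (y k) ystar \<le> E * h (K + n) powr (1 / 2)"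
      using dist[of "K + n"] assms unfolding n by (simp add: min_def split: if_splits)
    moreover have "E * \<tau> ^ n = c * \<tau> ^ k"
      using \<tau> by (simp add: c_def n power_add)
    ultimately show ?thesis by simp
  qed
  moreover have "0 < c" using E \<tau> by (simp add: c_def)
  ultimately show ?thesis using \<tau>(1,2) by (intro exI[of _ "Suc K"]) auto
qed

text \<open>With \<open>p = 2 \<theta> - 1\<close> as long as the gap is positive, \<open>h k powr (- p)\<close> grows by at least a constant in each step, as in
  the comparison with the differential equation \<open>h' = - \<mu> h powr (p + 1)\<close>; so \<open>h k\<close> decays like
  \<open>k powr (- 1 / p)\<close>.\<close>

theorem sublinear_rate:
  assumes half: "1 / 2 < \<theta>"
  shows "\<exists>k\<^sub>0>0. \<exists>c>0. \<forall>k\<ge>k\<^sub>0.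
    dist (y k) ystar \<le> c * real k powr (- ((1 - \<theta>) / (2 * \<theta> - 1)))"
proof -
  obtain K E where K: "N \<le> K" and E: "0 < E"
    and dist: "\<And>k. K \<le> k \<Longrightarrow> dist (y (Suc k)) ystar \<le> E * h k powr min (1 / 2) (1 - \<theta>)"
    and rec: "\<And>k. K \<le> k \<Longrightarrow> a / (M * (1 - \<theta>))\<^sup>2 * h (Suc k) powr (2 * \<theta>) \<le> h k - h (Suc k)"
    and h1: "\<And>k. K \<le> k \<Longrightarrow> h k \<le> 1"
    by (rule distance_le_gap) blast
  define \<mu> where "\<mu> = a / (M * (1 - \<theta>))\<^sup>2"
  have \<mu>: "0 < \<mu>" using pos \<theta> by (simp add: \<mu>_def)
  define p where "p = 2 * \<theta> - 1"
  have p: "0 < p" using half by (simp add: p_def)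
  define \<omega> where "\<omega> = min (p * \<mu> * (1 / 2) powr (p + 1)) (2 powr p - 1)"
  have "2 powr 0 < (2::real) powr p" using p by (intro powr_less_mono) auto
  then have \<omega>: "0 < \<omega>" using p \<mu> by (simp add: \<omega>_def)
  have growth: "h k powr (- p) + \<omega> \<le> h (Suc k) powr (- p)" if k: "K \<le> k" and hs: "0 < h (Suc k)" for k
  proof -
    have hk: "0 < h k" "h (Suc k) \<le> h k" using h_Suc_le[of k] K k hs by auto
    show ?thesis
    \<comment> \<open>If the gap does not halve, old and new gap are comparable and the tangent bound applies;
      if it halves, the negative power grows by a fixed factor.\<close>
    proof (cases "h k / 2 \<le> h (Suc k)")
      case True
      have "p * \<mu> * (1 / 2) powr (p + 1) = p * h k powr (- p - 1) * (\<mu> * (h k / 2) powr (2 * \<theta>))"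
      proof -
        have "(h k / 2) powr (2 * \<theta>) = h k powr (p + 1) * (1 / 2) powr (p + 1)"
          using hk by (simp add: p_def powr_mult[symmetric])
        moreover have "h k powr (- p - 1) * h k powr (p + 1) = 1"
          using hk by (simp add: powr_add[symmetric])
        ultimately show ?thesis by (simp add: algebra_simps)
      qed
      also have "\<dots> \<le> p * h k powr (- p - 1) * (\<mu> * h (Suc k) powr (2 * \<theta>))"
        using True hk \<mu> p half by (intro mult_left_mono powr_mono2) auto
      also have "\<dots> \<le> p * h k powr (- p - 1) * (h k - h (Suc k))"
        using rec[OF k] p by (intro mult_left_mono) (auto simp: \<mu>_def)
      also have "\<dots> \<le> h (Suc k) powr (- p) - h k powr (- p)"
        using hk hs p by (intro powr_tangent_lower) auto
      finally show ?thesis by (simp add: \<omega>_def)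
    next
      case False
      have "1 \<le> h k powr (- p)"
        using powr_mono2'[of "- p" "h k" 1] hk h1[OF k] p by simp
      then have "(2 powr p - 1) * 1 \<le> (2 powr p - 1) * h k powr (- p)"
        using \<open>2 powr 0 < 2 powr p\<close> by (intro mult_left_mono) auto
      moreover have "(h k / 2) powr (- p) \<le> h (Suc k) powr (- p)"
        using False hs p by (intro powr_mono2') auto
      moreover have "(h k / 2) powr (- p) = 2 powr p * h k powr (- p)"
        using hk by (simp add: powr_divide powr_minus field_simps)
      ultimately show ?thesis by (simp add: \<omega>_def algebra_simps)
    qed
  qed
  have accumulated: "0 < h (K + n) \<Longrightarrow> \<omega> * real n \<le> h (K + n) powr (- p)" for n
  proof (induction n)
    case (Suc n)
    have "0 < h (K + n)" using Suc.prems h_Suc_le[of "K + n"] K by simp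
    then show ?case using Suc growth[of "K + n"] by (simp add: algebra_simps)
  qed simp
  define e where "e = (1 - \<theta>) / p"
  have e: "0 < e" using p \<theta> by (simp add: e_def)
  define c where "c = E * (\<omega> / 2) powr (- e)"
  \<comment> \<open>From index \<open>2 K + 3\<close> on, at least half of the steps were made in the asymptotic regime.\<close>
  have "dist (y k) ystar \<le> c * real k powr (- e)" if k: "2 * K + 3 \<le> k" for k
  proof -
    obtain n where n: "k = Suc (K + n)" using k by (metis add_Suc add_leE le_Suc_ex mult_2 numeral_3_eq_3 add_Suc_right)
    have kn: "real k / 2 \<le> real n" "0 < n" using k n by auto
    have "h (K + n) powr (1 - \<theta>) \<le> (\<omega> / 2 * real k) powr (- e)"
    proof (cases "h (K + n) = 0")
      case False
      then have hpos: "0 < h (K + n)" using h_nonneg[of "K + n"] K by simp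
      have "\<omega> / 2 * real k \<le> \<omega> * real n" using kn \<omega> by simp
      then have "\<omega> / 2 * real k \<le> h (K + n) powr (- p)" using accumulated[OF hpos] by simp
      then have "(h (K + n) powr (- p)) powr (- e) \<le> (\<omega> / 2 * real k) powr (- e)"
        using \<omega> e k by (intro powr_mono2') auto
      then show ?thesis using p by (simp add: powr_powr e_def)
    qed simp
    also have "\<dots> = (\<omega> / 2) powr (- e) * real k powr (- e)"
      using \<omega> by (subst powr_mult) auto
    finally have "E * h (K + n) powr (1 - \<theta>) \<le> c * real k powr (- e)"
      using E by (simp add: c_def)
    moreover have "min (1 / 2) (1 - \<theta>) = 1 - \<theta>" using half by simp
    ultimately show ?thesis using dist[of "K + n"] n by simp
  qed
  moreover have "0 < c" using E \<omega> by (simp add: c_def)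
  ultimately show ?thesis unfolding e_def p_def by (intro exI[of _ "2 * K + 3"]) auto
qed

end

section \<open>Descent and subgradients along a MEAL run\<close>

lemma norm_quadruple_le:
  "norm (p, q, m, n) \<le> norm p + norm q + norm m + norm n"
  using norm_Pair_le[of p "(q, m, n)"] norm_Pair_le[of q "(m, n)"] norm_Pair_le[of m n] by linarith

text \<open>The potential is \<open>f\<close> plus a quadratic polynomial, whose expansion is exact. Its second-order part is
  a sum of squares except for the bilinear coupling of \<open>l\<close> and \<open>x\<close>, which costs the operator bound
  \<open>B\<close>. In the vector, the gradient of the polynomial is added to \<open>g\<close>.\<close>

lemma proximal_subgradient_P_meal:
  fixes A :: "real^'n^'m"
  assumes sub: "proximal_subgradient K f x g" and "0 \<le> K" "0 \<le> B" "0 < \<gamma>" "0 \<le> \<beta>" "0 \<le> \<alpha>"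
    and B: "\<And>u. norm (A *v u) \<le> B * norm u"
  shows "proximal_subgradient (K + B) (P_meal f A b \<gamma> \<beta> \<alpha>) (x, z, l, z')
    (g + transpose A *v (l + \<beta> *\<^sub>R (A *v x - b)) + (1 / \<gamma>) *\<^sub>R (x - z),
     (1 / \<gamma>) *\<^sub>R (z - x) + (6 * \<alpha>) *\<^sub>R (z - z'),
     A *v x - b,
     (6 * \<alpha>) *\<^sub>R (z' - z))"
  unfolding proximal_subgradient_def
proof
  fix u :: "(real^'n) \<times> (real^'n) \<times> (real^'m) \<times> (real^'n)"
  define p where "p = fst u - x"
  define q where "q = fst (snd u) - z"
  define m where "m = fst (snd (snd u)) - l"
  define n where "n = snd (snd (snd u)) - z'"
  define R where "R = A *v x - b"
  have u: "u = (x + p, z + q, l + m, z' + n)" by (simp add: p_def q_def m_def n_def)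
  have square: "(norm (v + w))\<^sup>2 = (norm v)\<^sup>2 + 2 * (v \<bullet> w) + (norm w)\<^sup>2" for v w :: "'c::real_inner"
    unfolding power2_norm_eq_inner by (simp add: inner_simps inner_commute)
  have AR: "A *v (x + p) - b = R + A *v p" by (simp add: R_def matrix_vector_right_distrib)
  have e1: "(norm (R + A *v p))\<^sup>2 = (norm R)\<^sup>2 + 2 * (R \<bullet> (A *v p)) + (norm (A *v p))\<^sup>2"
    by (rule square)
  have "(x + p) - (z + q) = (x - z) + (p - q)" by simp
  then have e2: "(norm ((x + p) - (z + q)))\<^sup>2
      = (norm (x - z))\<^sup>2 + 2 * ((x - z) \<bullet> (p - q)) + (norm (p - q))\<^sup>2"
    by (simp only: square)
  have "(z + q) - (z' + n) = (z - z') + (q - n)" by simp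
  then have e3: "(norm ((z + q) - (z' + n)))\<^sup>2
      = (norm (z - z'))\<^sup>2 + 2 * ((z - z') \<bullet> (q - n)) + (norm (q - n))\<^sup>2"
    by (simp only: square)
  define V where "V = (g + transpose A *v (l + \<beta> *\<^sub>R R) + (1 / \<gamma>) *\<^sub>R (x - z),
     (1 / \<gamma>) *\<^sub>R (z - x) + (6 * \<alpha>) *\<^sub>R (z - z'), R, (6 * \<alpha>) *\<^sub>R (z' - z))"
  have V: "V \<bullet> (p, q, m, n) = g \<bullet> p + (l + \<beta> *\<^sub>R R) \<bullet> (A *v p) + 1 / \<gamma> * ((x - z) \<bullet> (p - q))
      + 6 * \<alpha> * ((z - z') \<bullet> (q - n)) + R \<bullet> m"
    unfolding V_def inner_Pair inner_add_left matrix_transpose_inner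
    by (simp add: inner_simps algebra_simps diff_divide_distrib)
  have "P_meal f A b \<gamma> \<beta> \<alpha> u - P_meal f A b \<gamma> \<beta> \<alpha> (x, z, l, z') - V \<bullet> (p, q, m, n)
      = (f (x + p) - f x - g \<bullet> p) + m \<bullet> (A *v p) + \<beta> / 2 * (norm (A *v p))\<^sup>2
        + 1 / (2 * \<gamma>) * (norm (p - q))\<^sup>2 + 3 * \<alpha> * (norm (q - n))\<^sup>2"
  proof -
    define a where "a = 1 / (2 * \<gamma>)"
    have a: "1 / \<gamma> = 2 * a" by (simp add: a_def)
    have bilinear: "(l + m) \<bullet> (R + A *v p) = l \<bullet> R + l \<bullet> (A *v p) + R \<bullet> m + m \<bullet> (A *v p)"
      "(l + \<beta> *\<^sub>R R) \<bullet> (A *v p) = l \<bullet> (A *v p) + \<beta> * (R \<bullet> (A *v p))"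
      by (simp_all add: inner_add_left inner_add_right inner_commute)
    show ?thesis
      unfolding V u P_meal_def prod.case prox_aug_Lagrangian_def aug_Lagrangian_def AR
        e1 e2 e3 R_def[symmetric] bilinear a a_def[symmetric]
      by (simp add: algebra_simps)
  qed
  moreover have "- K * (norm p)\<^sup>2 \<le> f (x + p) - f x - g \<bullet> p"
    using sub[unfolded proximal_subgradient_def, rule_format, of "x + p"] by simp
  moreover have "- (B * (norm m * norm p)) \<le> m \<bullet> (A *v p)"
  proof -
    have "\<bar>m \<bullet> (A *v p)\<bar> \<le> norm m * norm (A *v p)" by (rule Cauchy_Schwarz_ineq2)
    also have "\<dots> \<le> norm m * (B * norm p)" by (intro mult_left_mono B) auto
    finally show ?thesis by (simp add: algebra_simps)
  qed
  moreover have "0 \<le> \<beta> / 2 * (norm (A *v p))\<^sup>2" "0 \<le> 1 / (2 * \<gamma>) * (norm (p - q))\<^sup>2"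
    "0 \<le> 3 * \<alpha> * (norm (q - n))\<^sup>2"
    using assms by auto
  ultimately have "- K * (norm p)\<^sup>2 - B * (norm m * norm p)
      \<le> P_meal f A b \<gamma> \<beta> \<alpha> u - P_meal f A b \<gamma> \<beta> \<alpha> (x, z, l, z') - V \<bullet> (p, q, m, n)"
    by linarith
  moreover have "K * (norm p)\<^sup>2 + B * (norm m * norm p) \<le> (K + B) * (norm (p, q, m, n))\<^sup>2"
  proof -
    have n: "(norm (p, q, m, n))\<^sup>2 = (norm p)\<^sup>2 + (norm q)\<^sup>2 + (norm m)\<^sup>2 + (norm n)\<^sup>2"
      by (simp add: norm_Pair)
    have "2 * (norm m * norm p) \<le> (norm m)\<^sup>2 + (norm p)\<^sup>2"
      using sum_squares_bound[of "norm m" "norm p"] by simp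
    moreover have "0 \<le> norm m * norm p" "0 \<le> (norm q)\<^sup>2" "0 \<le> (norm n)\<^sup>2" by simp_all
    ultimately have "norm m * norm p \<le> (norm (p, q, m, n))\<^sup>2"
      unfolding n by linarith
    then have "B * (norm m * norm p) \<le> B * (norm (p, q, m, n))\<^sup>2"
      using \<open>0 \<le> B\<close> by (rule mult_left_mono)
    moreover have "K * (norm p)\<^sup>2 \<le> K * (norm (p, q, m, n))\<^sup>2"
      unfolding n using \<open>0 \<le> K\<close> by (intro mult_left_mono) auto
    ultimately show ?thesis by (simp add: distrib_right)
  qed
  moreover have "u - (x, z, l, z') = (p, q, m, n)" by (simp add: u)
  ultimately have "P_meal f A b \<gamma> \<beta> \<alpha> (x, z, l, z') + V \<bullet> (u - (x, z, l, z'))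
      - (K + B) * (norm (u - (x, z, l, z')))\<^sup>2 \<le> P_meal f A b \<gamma> \<beta> \<alpha> u"
    by simp
  then show "P_meal f A b \<gamma> \<beta> \<alpha> (x, z, l, z')
     + (g + transpose A *v (l + \<beta> *\<^sub>R (A *v x - b)) + (1 / \<gamma>) *\<^sub>R (x - z),
        (1 / \<gamma>) *\<^sub>R (z - x) + (6 * \<alpha>) *\<^sub>R (z - z'), A *v x - b, (6 * \<alpha>) *\<^sub>R (z' - z))
       \<bullet> (u - (x, z, l, z'))
     - (K + B) * (norm (u - (x, z, l, z')))\<^sup>2 \<le> P_meal f A b \<gamma> \<beta> \<alpha> u"
    by (simp only: V_def R_def)
qed

locale MEAL_run =
  fixes f :: "real^'n \<Rightarrow> real" and A :: "real^'n^'m" and b :: "real^'m"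
    and \<rho> \<gamma> \<eta> \<beta> \<alpha> :: real and L\<^sub>f :: "real \<Rightarrow> real"
    and x z :: "nat \<Rightarrow> real^'n" and l :: "nat \<Rightarrow> real^'m"
  assumes A_nonzero: "A \<noteq> 0"
    and feasible: "{u. A *v u = b} \<noteq> {}"
    and weakly_convex: "weakly_convex \<rho> f"
    and Lipschitz: "implicit_Lipschitz_subgradient \<rho> f L\<^sub>f"
    and gamma: "0 < \<gamma>" "\<gamma> < 1 / \<rho>"
    and eta: "0 < \<eta>" "\<eta> < 2"
    and beta: "\<beta> > 0"
    and alpha_def: "\<alpha> = alpha_meal A \<gamma> \<beta> \<eta>"
    and alpha_less: "\<alpha> < min ((1 - \<gamma> * \<rho>) / (4 * \<gamma> * (1 + \<gamma> * L\<^sub>f \<gamma>)\<^sup>2))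
                              (1 / (8 * \<gamma>) * (2 / \<eta> - 1))"
    and meal: "MEAL f A b \<gamma> \<beta> \<eta> x z l"
begin

text \<open>The subgradient of \<open>f\<close> at \<open>x (Suc k)\<close> singled out by optimality of the subproblem, after the
  penalty gradient has been absorbed into the new multiplier.\<close>

definition subgrad :: "nat \<Rightarrow> real^'n" where
  "subgrad k = - (transpose A *v l (Suc k)) - (1 / \<gamma>) *\<^sub>R (x (Suc k) - z k)"

lemma rho: "0 < \<rho>" "\<gamma> * \<rho> < 1"
proof -
  show "0 < \<rho>" using weakly_convex by (simp add: weakly_convex_def)
  then show "\<gamma> * \<rho> < 1" using gamma by (simp add: field_simps)
qed

lemma L_pos: "0 < L\<^sub>f \<gamma>"
  using Lipschitz gamma by (simp add: implicit_Lipschitz_subgradient_def)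

lemma z_Suc: "z (Suc k) = z k - \<eta> *\<^sub>R (z k - x (Suc k))"
  and l_Suc: "l (Suc k) = l k + \<beta> *\<^sub>R (A *v x (Suc k) - b)"
  using meal by (auto simp: MEAL_def)

lemma x_minus_z: "x (Suc k) - z k = (1 / \<eta>) *\<^sub>R (z (Suc k) - z k)"
  using eta by (simp add: z_Suc scaleR_diff_right)

lemma residual: "A *v x (Suc k) - b = (1 / \<beta>) *\<^sub>R (l (Suc k) - l k)"
  using beta by (simp add: l_Suc)

lemma continuous_f: "continuous_on UNIV f"
proof -
  have "continuous_on UNIV (\<lambda>u. f u + \<rho> / 2 * (norm u)\<^sup>2)"
    using weakly_convex by (intro convex_on_continuous) (auto simp: weakly_convex_def)
  then have "continuous_on UNIV (\<lambda>u. (f u + \<rho> / 2 * (norm u)\<^sup>2) - \<rho> / 2 * (norm u)\<^sup>2)"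
    by (rule continuous_on_diff) (intro continuous_intros)
  then show ?thesis by simp
qed

text \<open>Exact second-order expansion of the subproblem at its solution: the linear terms combine to
  \<open>- subgrad k\<close>. It serves twice, to recognise \<open>subgrad k\<close> as a subgradient and to measure the primal decrease.\<close>

lemma subproblem_expansion:
  "prox_aug_Lagrangian f A b \<gamma> \<beta> u (z k) (l k)
   = prox_aug_Lagrangian f A b \<gamma> \<beta> (x (Suc k)) (z k) (l k)
     + (f u - f (x (Suc k)) - subgrad k \<bullet> (u - x (Suc k)))
     + \<beta> / 2 * (norm (A *v (u - x (Suc k))))\<^sup>2 + 1 / (2 * \<gamma>) * (norm (u - x (Suc k)))\<^sup>2"
proof -
  define s where "s = u - x (Suc k)"
  define R where "R = A *v x (Suc k) - b"
  have square: "(norm (v + w))\<^sup>2 = (norm v)\<^sup>2 + 2 * (v \<bullet> w) + (norm w)\<^sup>2" for v w :: "'c::real_inner"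
    unfolding power2_norm_eq_inner by (simp add: inner_simps inner_commute)
  have Au: "A *v u - b = R + A *v s" by (simp add: R_def s_def matrix_vector_mult_diff_distrib)
  have uz: "u - z k = (x (Suc k) - z k) + s" by (simp add: s_def)
  have slope: "subgrad k \<bullet> s = - ((l k + \<beta> *\<^sub>R R) \<bullet> (A *v s)) - 1 / \<gamma> * ((x (Suc k) - z k) \<bullet> s)"
    unfolding subgrad_def l_Suc R_def[symmetric] inner_diff_left inner_minus_left matrix_transpose_inner
      inner_scaleR_left ..
  show ?thesis
    unfolding prox_aug_Lagrangian_def aug_Lagrangian_def Au uz square s_def[symmetric] slope R_def[symmetric]
    using gamma by (simp add: inner_simps field_simps)
qed

lemma proximal_subgradient_subgrad: "proximal_subgradient (\<rho> / 2) f (x (Suc k)) (subgrad k)"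
proof -
  obtain B where B: "0 < B" "\<And>u. norm (A *v u) \<le> norm u * B"
    using bounded_linear.pos_bounded[OF matrix_vector_mul_bounded_linear[of A]] by blast
  define K where "K = \<beta> / 2 * B\<^sup>2 + 1 / (2 * \<gamma>)"
  have "proximal_subgradient K f (x (Suc k)) (subgrad k)"
    unfolding proximal_subgradient_def
  proof
    fix u
    define s where "s = u - x (Suc k)"
    have "prox_aug_Lagrangian f A b \<gamma> \<beta> (x (Suc k)) (z k) (l k) \<le> prox_aug_Lagrangian f A b \<gamma> \<beta> u (z k) (l k)"
      using meal unfolding MEAL_def is_arg_min_def prox_aug_Lagrangian_def by (meson not_less)
    then have "f (x (Suc k)) + subgrad k \<bullet> s - \<beta> / 2 * (norm (A *v s))\<^sup>2 - 1 / (2 * \<gamma>) * (norm s)\<^sup>2 \<le> f u"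
      using subproblem_expansion[of u k] by (simp add: s_def)
    moreover have "\<beta> / 2 * (norm (A *v s))\<^sup>2 \<le> \<beta> / 2 * (norm s * B)\<^sup>2"
      using beta B by (intro mult_left_mono power_mono) auto
    then have "\<beta> / 2 * (norm (A *v s))\<^sup>2 \<le> \<beta> / 2 * B\<^sup>2 * (norm s)\<^sup>2"
      by (simp add: power_mult_distrib mult_ac)
    ultimately show "f (x (Suc k)) + subgrad k \<bullet> (u - x (Suc k)) - K * (norm (u - x (Suc k)))\<^sup>2 \<le> f u"
      unfolding K_def s_def[symmetric] distrib_right by linarith
  qed
  with weakly_convex show ?thesis by (rule weakly_convex_improve_proximal_subgradient)
qed

text \<open>\<open>subgrad k\<close> is the gradient of the Moreau envelope at \<open>x (Suc k) + \<gamma> subgrad k\<close>, a point whose proximal point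
  is \<open>x (Suc k)\<close>, so the implicit Lipschitz property applies.\<close>

lemma subgrad_Lipschitz: "norm (subgrad (Suc k) - subgrad k) \<le> L\<^sub>f \<gamma> * norm (x (Suc (Suc k)) - x (Suc k))"
proof -
  have prox: "prox \<gamma> f (x (Suc j) + \<gamma> *\<^sub>R subgrad j) = x (Suc j)" for j
    using proximal_subgradient_subgrad gamma(1) rho(2) by (rule prox_eqI)
  have grad: "gradient (moreau_envelope \<gamma> f) (x (Suc j) + \<gamma> *\<^sub>R subgrad j) = subgrad j" for j
    using proximal_subgradient_subgrad gamma(1) rho(2) by (rule gradient_moreau_envelope)
  have mem: "x (Suc j) \<in> range (prox \<gamma> f)" for j
    using rangeI[of "prox \<gamma> f" "x (Suc j) + \<gamma> *\<^sub>R subgrad j"] unfolding prox .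
  have fibre: "x (Suc j) + \<gamma> *\<^sub>R subgrad j \<in> prox \<gamma> f -` {x (Suc j)}" for j
    by (simp add: prox)
  have "norm (gradient (moreau_envelope \<gamma> f) (x (Suc (Suc k)) + \<gamma> *\<^sub>R subgrad (Suc k))
        - gradient (moreau_envelope \<gamma> f) (x (Suc k) + \<gamma> *\<^sub>R subgrad k))
      \<le> L\<^sub>f \<gamma> * norm (x (Suc (Suc k)) - x (Suc k))"
    using Lipschitz[unfolded implicit_Lipschitz_subgradient_def, THEN spec, THEN mp,
        OF conjI[OF gamma], THEN conjunct2, rule_format, OF mem mem fibre fibre] .
  then show ?thesis by (simp add: grad)
qed

lemma c_pos: "0 < c_meal \<gamma> A"
  using smallest_pos_eigenvalue_gram(1)[OF A_nonzero] gamma by (simp add: c_meal_def)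

text \<open>Taking differences in the definition of \<open>subgrad\<close> expresses \<open>A\<^sup>T\<close> applied to the multiplier step by
  primal steps. The multiplier step lies in the range of \<open>A\<close> because \<open>b\<close> does, so the spectral
  bound can be inverted.\<close>

lemma multiplier_step:
  "sqrt (c_meal \<gamma> A) * norm (l (Suc (Suc k)) - l (Suc k))
   \<le> (1 + \<gamma> * L\<^sub>f \<gamma>) * norm (x (Suc (Suc k)) - x (Suc k)) + norm (z (Suc k) - z k)"
    (is "_ \<le> ?rhs")
proof -
  define \<Lambda> where "\<Lambda> = l (Suc (Suc k)) - l (Suc k)"
  define \<sigma> where "\<sigma> = smallest_pos_eigenvalue (transpose A ** A)"
  obtain u0 where u0: "A *v u0 = b" using feasible by blast
  have \<Lambda>_range: "\<Lambda> = A *v (\<beta> *\<^sub>R (x (Suc (Suc k)) - u0))"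
    by (simp add: \<Lambda>_def l_Suc[of "Suc k"] u0 matrix_vector_mult_scaleR matrix_vector_mult_diff_distrib)
  have "\<sigma> * (norm \<Lambda>)\<^sup>2 \<le> (norm (transpose A *v \<Lambda>))\<^sup>2"
    unfolding \<Lambda>_range \<sigma>_def by (rule smallest_pos_eigenvalue_gram(2)[OF A_nonzero])
  then have "\<gamma>\<^sup>2 * (\<sigma> * (norm \<Lambda>)\<^sup>2) \<le> \<gamma>\<^sup>2 * (norm (transpose A *v \<Lambda>))\<^sup>2"
    by (rule mult_left_mono) simp
  moreover have "(sqrt (c_meal \<gamma> A))\<^sup>2 = \<gamma>\<^sup>2 * \<sigma>"
    using c_pos by (simp add: c_meal_def \<sigma>_def)
  ultimately have "(sqrt (c_meal \<gamma> A) * norm \<Lambda>)\<^sup>2 \<le> (\<gamma> * norm (transpose A *v \<Lambda>))\<^sup>2"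
    by (simp only: power_mult_distrib mult.assoc)
  then have "sqrt (c_meal \<gamma> A) * norm \<Lambda> \<le> \<gamma> * norm (transpose A *v \<Lambda>)"
    by (rule power2_le_imp_le) (use gamma in simp)
  moreover have "\<gamma> * norm (transpose A *v \<Lambda>) = norm (\<gamma> *\<^sub>R (transpose A *v \<Lambda>))"
    using gamma by simp
  moreover have balance: "\<gamma> *\<^sub>R (transpose A *v \<Lambda>) = (z (Suc k) - z k) - \<gamma> *\<^sub>R (subgrad (Suc k) - subgrad k)
      - (x (Suc (Suc k)) - x (Suc k))"
    using gamma by (simp add: subgrad_def \<Lambda>_def matrix_vector_mult_diff_distrib algebra_simps)
  moreover have "norm ((z (Suc k) - z k) - \<gamma> *\<^sub>R (subgrad (Suc k) - subgrad k) - (x (Suc (Suc k)) - x (Suc k)))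
      \<le> norm (z (Suc k) - z k) + norm (\<gamma> *\<^sub>R (subgrad (Suc k) - subgrad k)) + norm (x (Suc (Suc k)) - x (Suc k))"
    by (rule order_trans[OF norm_triangle_ineq4 add_right_mono[OF norm_triangle_ineq4]])
  moreover have "norm (\<gamma> *\<^sub>R (subgrad (Suc k) - subgrad k)) \<le> \<gamma> * (L\<^sub>f \<gamma> * norm (x (Suc (Suc k)) - x (Suc k)))"
    using gamma(1) subgrad_Lipschitz[of k] by simp
  ultimately have "sqrt (c_meal \<gamma> A) * norm \<Lambda>
      \<le> norm (z (Suc k) - z k) + \<gamma> * (L\<^sub>f \<gamma> * norm (x (Suc (Suc k)) - x (Suc k)))
        + norm (x (Suc (Suc k)) - x (Suc k))"
    unfolding balance by linarith
  then show ?thesis by (simp add: \<Lambda>_def distrib_right)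
qed

lemma alpha_pos: "0 < \<alpha>"
proof -
  have "0 < 2 * \<beta> + \<gamma> * \<eta> * (1 - \<eta> / 2)"
    using beta gamma eta by (intro add_pos_pos mult_pos_pos) auto
  then show ?thesis using c_pos beta by (simp add: alpha_def alpha_meal_def)
qed

lemma beta_alpha: "1 / \<beta> \<le> \<alpha> * c_meal \<gamma> A"
proof -
  have "\<alpha> * c_meal \<gamma> A = 1 / \<beta> + \<gamma> * \<eta> * (1 - \<eta> / 2) / (2 * \<beta>\<^sup>2)"
    using c_pos beta by (simp add: alpha_def alpha_meal_def field_simps power2_eq_square)
  moreover have "0 \<le> \<gamma> * \<eta> * (1 - \<eta> / 2) / (2 * \<beta>\<^sup>2)"
    using gamma eta by simp
  ultimately show ?thesis by simp
qed

text \<open>The argument at which the potential is evaluated; the last component is the previous \<open>z\<close>, so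
  only the states from index 1 on belong to the method.\<close>

definition state :: "nat \<Rightarrow> (real^'n) \<times> (real^'n) \<times> (real^'m) \<times> (real^'n)" where
  "state k = (x k, z k, l k, z (k - 1))"

text \<open>The previous step of \<open>z\<close> is included because the multiplier step is controlled by it. All
  three differences are genuine from index 2 on.\<close>

definition step :: "nat \<Rightarrow> real" where
  "step k = norm (x k - x (k - 1)) + norm (z k - z (k - 1)) + norm (z (k - 1) - z (k - 2))"

lemma step_Suc_Suc:
  "step (Suc (Suc k)) = norm (x (Suc (Suc k)) - x (Suc k)) + norm (z (Suc (Suc k)) - z (Suc k))
     + norm (z (Suc k) - z k)"
  by (simp add: step_def numeral_2_eq_2)

lemma step_nonneg: "0 \<le> step k"
  by (simp add: step_def)

definition potential :: "(real^'n) \<times> (real^'n) \<times> (real^'m) \<times> (real^'n) \<Rightarrow> real" where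
  "potential = P_meal f A b \<gamma> \<beta> \<alpha>"

text \<open>Three updates, three contributions: strong convexity of the subproblem, the contraction
  \<open>x - z\<^sup>+ = (1 - \<eta>) (x - z)\<close>, and the increase caused by moving the multiplier along the residual.\<close>

lemma prox_aug_Lagrangian_descent:
  "prox_aug_Lagrangian f A b \<gamma> \<beta> (x (Suc k)) (z (Suc k)) (l (Suc k))
     + (1 / \<gamma> - \<rho>) / 2 * (norm (x (Suc k) - x k))\<^sup>2
     + 1 / (2 * \<gamma>) * (2 / \<eta> - 1) * (norm (z (Suc k) - z k))\<^sup>2
   \<le> prox_aug_Lagrangian f A b \<gamma> \<beta> (x k) (z k) (l k)
     + 1 / \<beta> * (norm (l (Suc k) - l k))\<^sup>2"
proof -
  have "f (x (Suc k)) + subgrad k \<bullet> (x k - x (Suc k)) - \<rho> / 2 * (norm (x k - x (Suc k)))\<^sup>2 \<le> f (x k)"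
    using proximal_subgradient_subgrad by (simp add: proximal_subgradient_def)
  moreover have "0 \<le> \<beta> / 2 * (norm (A *v (x k - x (Suc k))))\<^sup>2" using beta by simp
  moreover have "1 / (2 * \<gamma>) * (norm (x k - x (Suc k)))\<^sup>2 - \<rho> / 2 * (norm (x k - x (Suc k)))\<^sup>2
      = (1 / \<gamma> - \<rho>) / 2 * (norm (x (Suc k) - x k))\<^sup>2"
    using gamma by (simp add: norm_minus_commute[of "x k"] field_simps)
  ultimately have primal: "prox_aug_Lagrangian f A b \<gamma> \<beta> (x (Suc k)) (z k) (l k)
      + (1 / \<gamma> - \<rho>) / 2 * (norm (x (Suc k) - x k))\<^sup>2
      \<le> prox_aug_Lagrangian f A b \<gamma> \<beta> (x k) (z k) (l k)"
    using subproblem_expansion[of "x k" k] by linarith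
  have "x (Suc k) - z (Suc k) = (1 - \<eta>) *\<^sub>R (x (Suc k) - z k)"
    by (simp add: z_Suc algebra_simps)
  then have contract: "(norm (x (Suc k) - z (Suc k)))\<^sup>2 = (1 - \<eta>)\<^sup>2 * (norm (x (Suc k) - z k))\<^sup>2"
    by (simp add: power_mult_distrib)
  have relax: "norm (x (Suc k) - z k) = norm (z (Suc k) - z k) / \<eta>"
    unfolding x_minus_z using eta by simp
  have "1 / (2 * \<gamma>) * (norm (x (Suc k) - z (Suc k)))\<^sup>2
      = 1 / (2 * \<gamma>) * (norm (x (Suc k) - z k))\<^sup>2
        - 1 / (2 * \<gamma>) * (2 / \<eta> - 1) * (norm (z (Suc k) - z k))\<^sup>2"
    unfolding contract relax using eta gamma by (simp add: power2_eq_square field_simps)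
  moreover have "l (Suc k) \<bullet> (A *v x (Suc k) - b)
      = l k \<bullet> (A *v x (Suc k) - b) + 1 / \<beta> * (norm (l (Suc k) - l k))\<^sup>2"
    unfolding residual power2_norm_eq_inner by (simp add: inner_diff_left diff_divide_distrib)
  ultimately have "prox_aug_Lagrangian f A b \<gamma> \<beta> (x (Suc k)) (z (Suc k)) (l (Suc k))
      = prox_aug_Lagrangian f A b \<gamma> \<beta> (x (Suc k)) (z k) (l k)
        - 1 / (2 * \<gamma>) * (2 / \<eta> - 1) * (norm (z (Suc k) - z k))\<^sup>2
        + 1 / \<beta> * (norm (l (Suc k) - l k))\<^sup>2"
    unfolding prox_aug_Lagrangian_def aug_Lagrangian_def by linarith
  with primal show ?thesis by linarith
qed

lemma multiplier_cost:
  "1 / \<beta> * (norm (l (Suc (Suc k)) - l (Suc k)))\<^sup>2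
   \<le> 2 * \<alpha> * (1 + \<gamma> * L\<^sub>f \<gamma>)\<^sup>2 * (norm (x (Suc (Suc k)) - x (Suc k)))\<^sup>2
     + 2 * \<alpha> * (norm (z (Suc k) - z k))\<^sup>2"
proof -
  define p where "p = (1 + \<gamma> * L\<^sub>f \<gamma>) * norm (x (Suc (Suc k)) - x (Suc k))"
  define q where "q = norm (z (Suc k) - z k)"
  define \<Lambda> where "\<Lambda> = norm (l (Suc (Suc k)) - l (Suc k))"
  have "(sqrt (c_meal \<gamma> A) * \<Lambda>)\<^sup>2 \<le> (p + q)\<^sup>2"
    unfolding p_def q_def \<Lambda>_def using multiplier_step[of k] c_pos by (intro power_mono) auto
  also have "\<dots> \<le> 2 * p\<^sup>2 + 2 * q\<^sup>2"
    using zero_le_power2[of "p - q"] by (simp add: power2_eq_square algebra_simps)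
  finally have "\<alpha> * (c_meal \<gamma> A * \<Lambda>\<^sup>2) \<le> \<alpha> * (2 * p\<^sup>2 + 2 * q\<^sup>2)"
    using alpha_pos c_pos by (intro mult_left_mono) (auto simp: power_mult_distrib)
  moreover have "1 / \<beta> * \<Lambda>\<^sup>2 \<le> \<alpha> * c_meal \<gamma> A * \<Lambda>\<^sup>2"
    by (intro mult_right_mono beta_alpha) auto
  moreover have "\<alpha> * (2 * p\<^sup>2 + 2 * q\<^sup>2) = 2 * \<alpha> * (1 + \<gamma> * L\<^sub>f \<gamma>)\<^sup>2
      * (norm (x (Suc (Suc k)) - x (Suc k)))\<^sup>2 + 2 * \<alpha> * (norm (z (Suc k) - z k))\<^sup>2"
    by (simp add: p_def q_def power_mult_distrib distrib_left)
  ultimately show ?thesis by (simp add: \<Lambda>_def mult.assoc)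
qed

text \<open>The weight \<open>3 \<alpha>\<close> in the potential splits the multiplier cost so that all three squares are
  left with a positive coefficient: the previous step of \<open>z\<close> keeps \<open>3 \<alpha> - 2 \<alpha>\<close>, and the
  two bounds on \<open>\<alpha>\<close> take care of the steps of \<open>x\<close> and of \<open>z\<close>.\<close>

lemma sufficient_descent:
  obtains a where "0 < a" "\<And>k. 1 \<le> k \<Longrightarrow> potential (state (Suc k)) + a * (step (Suc k))\<^sup>2 \<le> potential (state k)"
proof -
  define S where "S = (1 + \<gamma> * L\<^sub>f \<gamma>)\<^sup>2"
  define a1 where "a1 = (1 / \<gamma> - \<rho>) / 2 - 2 * \<alpha> * S"
  define a2 where "a2 = 1 / (2 * \<gamma>) * (2 / \<eta> - 1) - 3 * \<alpha>"
  have "0 < S"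
    unfolding S_def using gamma L_pos by (intro zero_less_power add_pos_pos mult_pos_pos) auto
  then have "0 < 4 * \<gamma> * S" using gamma by simp
  moreover have "\<alpha> < (1 - \<gamma> * \<rho>) / (4 * \<gamma> * S)" using alpha_less by (simp add: S_def)
  ultimately have "\<alpha> * (4 * \<gamma> * S) < 1 - \<gamma> * \<rho>" by (simp only: pos_less_divide_eq)
  moreover have "a1 = (1 - \<gamma> * \<rho> - \<alpha> * (4 * \<gamma> * S)) / (2 * \<gamma>)"
    using gamma by (simp add: a1_def field_simps)
  ultimately have a1: "0 < a1" using gamma by simp
  have "\<alpha> < 1 / (8 * \<gamma>) * (2 / \<eta> - 1)" using alpha_less by simp
  moreover have "1 / (2 * \<gamma>) * (2 / \<eta> - 1) = 4 * (1 / (8 * \<gamma>) * (2 / \<eta> - 1))"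
    using gamma eta by (simp add: field_simps)
  ultimately have "4 * \<alpha> < 1 / (2 * \<gamma>) * (2 / \<eta> - 1)" by linarith
  then have a2: "0 < a2" using alpha_pos by (simp add: a2_def)
  define a where "a = min a1 (min a2 \<alpha>) / 3"
  have a: "0 < a" "3 * a \<le> a1" "3 * a \<le> a2" "3 * a \<le> \<alpha>"
    using a1 a2 alpha_pos by (auto simp: a_def)
  have "potential (state (Suc n)) + a * (step (Suc n))\<^sup>2 \<le> potential (state n)" if n1: "1 \<le> n" for n
  proof -
    obtain k where n: "n = Suc k" using n1 by (cases n) auto
    define X where "X = norm (x (Suc (Suc k)) - x (Suc k))"
    define Z where "Z = norm (z (Suc (Suc k)) - z (Suc k))"
    define W where "W = norm (z (Suc k) - z k)"
    have "potential (state (Suc n)) + a1 * X\<^sup>2 + a2 * Z\<^sup>2 + \<alpha> * W\<^sup>2 \<le> potential (state n)"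
      using prox_aug_Lagrangian_descent[of "Suc k"] multiplier_cost[of k]
      unfolding potential_def P_meal_def state_def prod.case n diff_Suc_1 X_def[symmetric] Z_def[symmetric]
        W_def[symmetric] S_def[symmetric] a1_def a2_def
      by (simp add: left_diff_distrib)
    moreover have "a * (X + Z + W)\<^sup>2 \<le> a * (3 * (X\<^sup>2 + Z\<^sup>2 + W\<^sup>2))"
    proof (rule mult_left_mono)
      show "(X + Z + W)\<^sup>2 \<le> 3 * (X\<^sup>2 + Z\<^sup>2 + W\<^sup>2)"
        using zero_le_power2[of "X - Z"] zero_le_power2[of "X - W"] zero_le_power2[of "Z - W"]
        by (simp add: power2_eq_square algebra_simps)
    qed (use a in simp)
    moreover have "3 * a * X\<^sup>2 \<le> a1 * X\<^sup>2" "3 * a * Z\<^sup>2 \<le> a2 * Z\<^sup>2" "3 * a * W\<^sup>2 \<le> \<alpha> * W\<^sup>2"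
      using a by (auto intro!: mult_right_mono)
    moreover have "a * (3 * (X\<^sup>2 + Z\<^sup>2 + W\<^sup>2)) = 3 * a * X\<^sup>2 + 3 * a * Z\<^sup>2 + 3 * a * W\<^sup>2"
      by (simp add: algebra_simps)
    moreover have "step (Suc n) = X + Z + W" by (simp add: n step_Suc_Suc X_def Z_def W_def)
    ultimately show ?thesis by simp
  qed
  then show thesis using that a(1) by blast
qed

lemma multiplier_step_le:
  obtains C where "0 < C" "\<And>k. 1 \<le> k \<Longrightarrow> norm (l (Suc k) - l k) \<le> C * step (Suc k)"
proof -
  define K where "K = 1 + \<gamma> * L\<^sub>f \<gamma>"
  define C where "C = K / sqrt (c_meal \<gamma> A)"
  have K: "1 \<le> K" using gamma(1) L_pos by (simp add: K_def)
  have c: "0 < sqrt (c_meal \<gamma> A)" using c_pos by simp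
  have "0 < C" unfolding C_def using K c by (intro divide_pos_pos) linarith+
  moreover have "norm (l (Suc n) - l n) \<le> C * step (Suc n)" if n1: "1 \<le> n" for n
  proof -
    obtain k where n: "n = Suc k" using n1 by (cases n) auto
    have "K * norm (x (Suc (Suc k)) - x (Suc k)) + norm (z (Suc k) - z k)
        \<le> K * norm (x (Suc (Suc k)) - x (Suc k)) + K * norm (z (Suc k) - z k)"
      using mult_right_mono[OF K norm_ge_zero[of "z (Suc k) - z k"]] by simp
    also have "\<dots> \<le> K * step (Suc n)"
      using K unfolding n step_Suc_Suc by (simp add: distrib_left)
    finally have "norm (l (Suc n) - l n) * sqrt (c_meal \<gamma> A) \<le> K * step (Suc n)"
      using multiplier_step[of k] unfolding n K_def mult.commute[of _ "sqrt (c_meal \<gamma> A)"]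
      by (rule order_trans[rotated])
    then have "norm (l (Suc n) - l n) \<le> K * step (Suc n) / sqrt (c_meal \<gamma> A)"
      by (simp only: pos_le_divide_eq[OF c])
    then show ?thesis by (simp add: C_def)
  qed
  ultimately show thesis by (rule that)
qed

lemma state_step_le:
  obtains D where "0 < D" "\<And>k. 1 \<le> k \<Longrightarrow> dist (state (Suc k)) (state k) \<le> D * step (Suc k)"
proof -
  obtain C where C: "0 < C" "\<And>k. 1 \<le> k \<Longrightarrow> norm (l (Suc k) - l k) \<le> C * step (Suc k)"
    by (rule multiplier_step_le) blast
  have bound: "dist (state (Suc n)) (state n) \<le> (1 + C) * step (Suc n)" if n1: "1 \<le> n" for n
  proof -
    obtain k where n: "n = Suc k" using n1 by (cases n) auto
    have "dist (state (Suc n)) (state n)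
        = norm (x (Suc n) - x n, z (Suc n) - z n, l (Suc n) - l n, z n - z k)"
      by (simp add: dist_norm state_def n)
    also have "\<dots> \<le> norm (x (Suc n) - x n) + norm (z (Suc n) - z n) + norm (l (Suc n) - l n) + norm (z n - z k)"
      by (rule norm_quadruple_le)
    also have "\<dots> = step (Suc n) + norm (l (Suc n) - l n)" by (simp add: n step_Suc_Suc)
    also have "\<dots> \<le> (1 + C) * step (Suc n)" using C(2)[OF n1] by (simp add: distrib_right)
    finally show ?thesis .
  qed
  have "0 < 1 + C" using C(1) by simp
  then show thesis using bound by (rule that)
qed

text \<open>In the subgradient of the potential at the new state, \<open>subgrad\<close> cancels all but the differences
  between old and new \<open>z\<close> and \<open>l\<close>; these are at most of the order of \<open>step\<close>.\<close>

lemma relative_error: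
  obtains C where "0 < C"
    "\<And>k. 2 \<le> k \<Longrightarrow> \<exists>v \<in> limiting_subdifferential potential (state k). norm v \<le> C * step k"
proof -
  obtain C where C: "0 < C" "\<And>k. 1 \<le> k \<Longrightarrow> norm (l (Suc k) - l k) \<le> C * step (Suc k)"
    by (rule multiplier_step_le) blast
  obtain B where B: "0 < B" "\<And>u. norm (A *v u) \<le> norm u * B"
    using bounded_linear.pos_bounded[OF matrix_vector_mul_bounded_linear[of A]] by blast
  obtain B' where B': "0 < B'" "\<And>u. norm (transpose A *v u) \<le> norm u * B'"
    using bounded_linear.pos_bounded[OF matrix_vector_mul_bounded_linear[of "transpose A"]] by blast
  define C' where "C' = (B' + 1 / \<beta>) * C + 1 / \<gamma> + 1 / \<gamma> * (1 + 1 / \<eta>) + 12 * \<alpha>"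
  have "\<exists>v \<in> limiting_subdifferential potential (state j). norm v \<le> C' * step j" if j2: "2 \<le> j" for j
  proof -
    obtain n where j: "j = Suc n" "1 \<le> n" using j2 by (cases j) auto
    define \<Delta> where "\<Delta> = z (Suc n) - z n"
    define \<Lambda> where "\<Lambda> = l (Suc n) - l n"
    have \<Delta>: "norm \<Delta> \<le> step j" by (simp add: \<Delta>_def j step_def)
    have \<Lambda>: "norm \<Lambda> \<le> C * step j" using C(2)[OF j(2)] by (simp add: \<Lambda>_def j)
    define v1 where "v1 = transpose A *v \<Lambda> - (1 / \<gamma>) *\<^sub>R \<Delta>"
    define v2 where "v2 = (1 / \<gamma>) *\<^sub>R ((1 - 1 / \<eta>) *\<^sub>R \<Delta>) + (6 * \<alpha>) *\<^sub>R \<Delta>"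
    define v where "v = (v1, v2, (1 / \<beta>) *\<^sub>R \<Lambda>, - ((6 * \<alpha>) *\<^sub>R \<Delta>))"
    have e1: "subgrad n + transpose A *v (l (Suc n) + \<beta> *\<^sub>R (A *v x (Suc n) - b)) + (1 / \<gamma>) *\<^sub>R (x (Suc n) - z (Suc n)) = v1"
    proof -
      have "l (Suc n) + \<beta> *\<^sub>R (A *v x (Suc n) - b) = l (Suc n) + \<Lambda>"
        by (simp add: \<Lambda>_def l_Suc)
      then show ?thesis
        by (simp add: subgrad_def v1_def \<Delta>_def matrix_vector_right_distrib scaleR_diff_right)
    qed
    have "z (Suc n) - x (Suc n) = \<Delta> - (x (Suc n) - z n)" by (simp add: \<Delta>_def)
    then have zx: "z (Suc n) - x (Suc n) = (1 - 1 / \<eta>) *\<^sub>R \<Delta>"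
      unfolding x_minus_z \<Delta>_def[symmetric] by (simp add: scaleR_diff_left)
    have "proximal_subgradient (\<rho> / 2 + B) potential (state j) v"
      using proximal_subgradient_P_meal[OF proximal_subgradient_subgrad[of n], of B \<gamma> \<beta> \<alpha> A b "z (Suc n)" "l (Suc n)" "z n",
          unfolded e1 zx, unfolded residual]
        rho B gamma beta alpha_pos
      by (simp add: potential_def state_def j v_def v2_def \<Delta>_def \<Lambda>_def mult.commute scaleR_diff_right)
    then have "v \<in> limiting_subdifferential potential (state j)"
      by (rule proximal_subgradient_imp_limiting)
    moreover have "norm v \<le> C' * step j"
    proof -
      have "norm v1 \<le> norm (transpose A *v \<Lambda>) + norm ((1 / \<gamma>) *\<^sub>R \<Delta>)"
        unfolding v1_def by (rule norm_triangle_ineq4)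
      then have v1: "norm v1 \<le> B' * norm \<Lambda> + 1 / \<gamma> * norm \<Delta>"
        using B'(2)[of \<Lambda>] gamma by (simp add: mult.commute)
      have "norm v2 \<le> norm ((1 / \<gamma>) *\<^sub>R ((1 - 1 / \<eta>) *\<^sub>R \<Delta>)) + norm ((6 * \<alpha>) *\<^sub>R \<Delta>)"
        unfolding v2_def by (rule norm_triangle_ineq)
      moreover have "norm ((1 / \<gamma>) *\<^sub>R ((1 - 1 / \<eta>) *\<^sub>R \<Delta>)) \<le> 1 / \<gamma> * ((1 + 1 / \<eta>) * norm \<Delta>)"
      proof -
        have "0 < 1 / \<eta>" using eta by simp
        then have "\<bar>1 - 1 / \<eta>\<bar> \<le> 1 + 1 / \<eta>" by linarith
        then have "\<bar>1 - 1 / \<eta>\<bar> * norm \<Delta> \<le> (1 + 1 / \<eta>) * norm \<Delta>"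
          by (rule mult_right_mono) simp
        then have "1 / \<gamma> * (\<bar>1 - 1 / \<eta>\<bar> * norm \<Delta>) \<le> 1 / \<gamma> * ((1 + 1 / \<eta>) * norm \<Delta>)"
          using gamma by (intro mult_left_mono) auto
        then show ?thesis using gamma by simp
      qed
      ultimately have v2: "norm v2 \<le> 1 / \<gamma> * (1 + 1 / \<eta>) * norm \<Delta> + 6 * \<alpha> * norm \<Delta>"
        using alpha_pos by (simp add: mult.assoc)
      have "norm v \<le> norm v1 + norm v2 + norm ((1 / \<beta>) *\<^sub>R \<Lambda>) + norm (- ((6 * \<alpha>) *\<^sub>R \<Delta>))"
        unfolding v_def by (rule norm_quadruple_le)
      also have "\<dots> = norm v1 + norm v2 + 1 / \<beta> * norm \<Lambda> + 6 * \<alpha> * norm \<Delta>"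
        using beta alpha_pos by simp
      also have "\<dots> \<le> (B' + 1 / \<beta>) * norm \<Lambda> + (1 / \<gamma> + 1 / \<gamma> * (1 + 1 / \<eta>) + 12 * \<alpha>) * norm \<Delta>"
        using v1 v2 unfolding distrib_right[of _ _ "norm _"] by linarith
      also have "\<dots> \<le> (B' + 1 / \<beta>) * (C * step j) + (1 / \<gamma> + 1 / \<gamma> * (1 + 1 / \<eta>) + 12 * \<alpha>) * step j"
        using \<Delta> \<Lambda> B' beta gamma eta alpha_pos by (intro add_mono mult_left_mono) auto
      also have "\<dots> = C' * step j" by (simp only: C'_def distrib_right mult.assoc)
      finally show ?thesis .
    qed
    ultimately show ?thesis by blast
  qed
  moreover have "0 < C'"
    using B' C beta gamma eta alpha_pos by (simp add: C'_def add_pos_pos)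
  ultimately show thesis using that by blast
qed

lemma continuous_potential: "continuous_on UNIV potential"
proof -
  have "continuous_on UNIV (\<lambda>y::(real^'n) \<times> (real^'n) \<times> (real^'m) \<times> (real^'n). f (fst y))"
    by (intro continuous_on_compose2[OF continuous_f] continuous_intros) auto
  moreover have "continuous_on UNIV (\<lambda>y::(real^'n) \<times> (real^'n) \<times> (real^'m) \<times> (real^'n). A *v fst y)"
    by (intro continuous_on_compose2[OF linear_continuous_on[OF matrix_vector_mul_bounded_linear]] continuous_intros) auto
  ultimately show ?thesis
    unfolding potential_def P_meal_def prox_aug_Lagrangian_def aug_Lagrangian_def case_prod_beta
    by (intro continuous_intros)
qed

text \<open>The potential exceeds the energy by \<open>\<alpha>\<close> times a square, so it inherits the lower bound.\<close>

lemma potential_convergent: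
  assumes "bdd_below (E_meal f A b \<gamma> \<beta> \<alpha> x z l ` {1..})"
  shows "convergent (\<lambda>k. potential (state k))"
proof -
  obtain m where m: "\<And>k. 1 \<le> k \<Longrightarrow> m \<le> E_meal f A b \<gamma> \<beta> \<alpha> x z l k"
    using assms unfolding bdd_below_def by auto
  obtain a where a: "0 < a"
    "\<And>k. 1 \<le> k \<Longrightarrow> potential (state (Suc k)) + a * (step (Suc k))\<^sup>2 \<le> potential (state k)"
    by (rule sufficient_descent) blast
  have "potential (state (Suc k)) \<le> potential (state k)" if "1 \<le> k" for k
    using a(2)[OF that] mult_nonneg_nonneg[OF less_imp_le[OF a(1)] zero_le_power2[of "step (Suc k)"]]
    by linarith
  then have decseq: "decseq (\<lambda>k. potential (state (Suc k)))"
    by (intro decseq_SucI) simp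
  have lower: "m \<le> potential (state (Suc k))" for k
  proof -
    have "0 \<le> \<alpha> * (norm (z (Suc k) - z k))\<^sup>2" using alpha_pos by simp
    then show ?thesis
      using m[of "Suc k"]
      by (simp add: potential_def P_meal_def state_def E_meal_def)
  qed
  obtain c where "(\<lambda>k. potential (state (Suc k))) \<longlonglongrightarrow> c"
    by (rule decseq_convergent[OF decseq, of m]) (use lower in auto)
  then have "(\<lambda>k. potential (state k)) \<longlonglongrightarrow> c" by (rule LIMSEQ_imp_Suc)
  then show ?thesis by (rule convergentI)
qed

lemma step_tendsto:
  assumes "bdd_below (E_meal f A b \<gamma> \<beta> \<alpha> x z l ` {1..})"
  shows "step \<longlonglongrightarrow> 0"
proof -
  obtain a where a: "0 < a"
    "\<And>k. 1 \<le> k \<Longrightarrow> potential (state (Suc k)) + a * (step (Suc k))\<^sup>2 \<le> potential (state k)"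
    by (rule sufficient_descent) blast
  show ?thesis
    by (rule descent_steps_tendsto_zero[OF a(1) potential_convergent[OF assms], of 1]) (rule a(2))
qed

text \<open>Vanishing steps force \<open>z - x\<close> and \<open>z k - z (k - 1)\<close> to 0, so both copies of \<open>z\<close> follow \<open>x\<close>.\<close>

lemma state_subseq_tendsto:
  assumes step: "step \<longlonglongrightarrow> 0" and r: "strict_mono r"
    and lim: "(\<lambda>k. (x (r k), l (r k))) \<longlonglongrightarrow> (xstar, lstar)"
  shows "(\<lambda>k. state (r k)) \<longlonglongrightarrow> (xstar, xstar, lstar, xstar)"
proof -
  have xz: "(\<lambda>k. z (Suc k) - x (Suc k)) \<longlonglongrightarrow> 0"
  proof (rule Lim_null_comparison)
    have "norm (z (Suc k) - x (Suc k)) \<le> (1 + 1 / \<eta>) * step (Suc k)" for k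
    proof -
      have "z (Suc k) - x (Suc k) = (z (Suc k) - z k) - (1 / \<eta>) *\<^sub>R (z (Suc k) - z k)"
        using x_minus_z[of k] by (simp add: algebra_simps)
      then have "norm (z (Suc k) - x (Suc k))
          \<le> norm (z (Suc k) - z k) + norm ((1 / \<eta>) *\<^sub>R (z (Suc k) - z k))"
        by (simp only: norm_triangle_ineq4)
      also have "\<dots> = (1 + 1 / \<eta>) * norm (z (Suc k) - z k)"
        using eta by (simp add: distrib_right)
      also have "\<dots> \<le> (1 + 1 / \<eta>) * step (Suc k)"
        using eta by (intro mult_left_mono) (auto simp: step_def)
      finally show ?thesis .
    qed
    then show "\<forall>\<^sub>F k in sequentially. norm (z (Suc k) - x (Suc k)) \<le> (1 + 1 / \<eta>) * step (Suc k)"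
      by simp
    show "(\<lambda>k. (1 + 1 / \<eta>) * step (Suc k)) \<longlonglongrightarrow> 0"
      by (intro tendsto_mult_right_zero LIMSEQ_Suc step)
  qed
  then have xz: "(\<lambda>k. z k - x k) \<longlonglongrightarrow> 0" by (rule LIMSEQ_imp_Suc)
  have zz: "(\<lambda>k. z k - z (k - 1)) \<longlonglongrightarrow> 0"
    by (rule Lim_null_comparison[OF _ step]) (auto simp: step_def)
  have xr: "(\<lambda>k. x (r k)) \<longlonglongrightarrow> xstar" and lr: "(\<lambda>k. l (r k)) \<longlonglongrightarrow> lstar"
    using tendsto_fst[OF lim] tendsto_snd[OF lim] by simp_all
  have "(\<lambda>k. (z (r k) - x (r k)) + x (r k)) \<longlonglongrightarrow> 0 + xstar"
    using LIMSEQ_subseq_LIMSEQ[OF xz r] by (intro tendsto_add xr) (simp add: o_def)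
  then have zr: "(\<lambda>k. z (r k)) \<longlonglongrightarrow> xstar" by simp
  have "(\<lambda>k. z (r k) - (z (r k) - z (r k - 1))) \<longlonglongrightarrow> xstar - 0"
    using LIMSEQ_subseq_LIMSEQ[OF zz r] by (intro tendsto_diff zr) (simp add: o_def)
  then have "(\<lambda>k. z (r k - 1)) \<longlonglongrightarrow> xstar" by simp
  with xr zr lr show ?thesis unfolding state_def by (intro tendsto_Pair)
qed

text \<open>The desingularising function \<open>c s powr (1 - \<theta>)\<close> has slope \<open>c (1 - \<theta>) s powr (- \<theta>)\<close>, so \<open>M\<close> is \<open>c\<close>
  times the constant of the relative error. The start index 2 is the first at which the latter holds.\<close>

lemma KL_descent_state:
  assumes bounded: "bdd_below (E_meal f A b \<gamma> \<beta> \<alpha> x z l ` {1..})"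
    and limit_point: "\<exists>r. strict_mono r \<and> (\<lambda>k. (x (r k), l (r k))) \<longlonglongrightarrow> (xstar, lstar)"
    and KL: "KL_property (P_meal f A b \<gamma> \<beta> \<alpha>) (xstar, xstar, lstar, xstar) \<theta>"
  shows "\<exists>a M D r \<nu>. KL_descent state (xstar, xstar, lstar, xstar)
    (\<lambda>k. potential (state k) - potential (xstar, xstar, lstar, xstar)) step \<theta> a M D r \<nu> 2"
proof -
  define ystar where "ystar = (xstar, xstar, lstar, xstar)"
  define h where "h k = potential (state k) - potential ystar" for k
  obtain a where a: "0 < a"
    "\<And>k. 1 \<le> k \<Longrightarrow> potential (state (Suc k)) + a * (step (Suc k))\<^sup>2 \<le> potential (state k)"
    by (rule sufficient_descent) blast
  obtain D where D: "0 < D" "\<And>k. 1 \<le> k \<Longrightarrow> dist (state (Suc k)) (state k) \<le> D * step (Suc k)"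
    by (rule state_step_le) blast
  obtain C where C: "0 < C"
    "\<And>k. 2 \<le> k \<Longrightarrow> \<exists>v \<in> limiting_subdifferential potential (state k). norm v \<le> C * step k"
    by (rule relative_error) blast
  have \<theta>: "0 \<le> \<theta>" "\<theta> < 1" using KL by (auto simp: KL_property_def)
  obtain U \<nu> c where U: "open U" "ystar \<in> U" and pos: "0 < \<nu>" "0 < c"
    and KL_near: "\<forall>y \<in> U \<inter> dom_subdifferential potential. potential ystar < potential y \<and>
      potential y < potential ystar + \<nu> \<longrightarrow>
      1 \<le> deriv (\<lambda>s. c * s powr (1 - \<theta>)) (potential y - potential ystar)
            * infdist 0 (limiting_subdifferential potential y)"
    using KL[unfolded KL_property_def, folded potential_def ystar_def] by (elim exE conjE)
  obtain r where r: "0 < r" "ball ystar r \<subseteq> U" using U openE by blast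
  have step0: "step \<longlonglongrightarrow> 0" using bounded by (rule step_tendsto)
  obtain s where s: "strict_mono s" "(\<lambda>k. state (s k)) \<longlonglongrightarrow> ystar"
    using limit_point state_subseq_tendsto[OF step0] unfolding ystar_def by blast
  have "h \<longlonglongrightarrow> 0"
  proof -
    obtain p where p: "(\<lambda>k. potential (state k)) \<longlonglongrightarrow> p"
      using potential_convergent[OF bounded] by (auto simp: convergent_def)
    have "(\<lambda>k. potential (state (s k))) \<longlonglongrightarrow> p"
      using LIMSEQ_subseq_LIMSEQ[OF p s(1)] by (simp add: o_def)
    moreover have "(\<lambda>k. potential (state (s k))) \<longlonglongrightarrow> potential ystar"
      by (rule continuous_on_tendsto_compose[OF continuous_potential s(2)]) auto
    ultimately have "p = potential ystar" by (rule LIMSEQ_unique)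
    with p show ?thesis unfolding h_def LIM_zero_iff by simp
  qed
  moreover have "1 \<le> c * C * (1 - \<theta>) * h k powr (- \<theta>) * step k"
    if k: "2 \<le> k" and near: "dist (state k) ystar < r" and gap: "0 < h k" "h k < \<nu>" for k
  proof -
    obtain v where v: "v \<in> limiting_subdifferential potential (state k)" "norm v \<le> C * step k"
      using C(2)[OF k] by blast
    have "infdist 0 (limiting_subdifferential potential (state k)) \<le> dist 0 v"
      using v(1) by (rule infdist_le)
    then have infdist: "infdist 0 (limiting_subdifferential potential (state k)) \<le> C * step k"
      using v(2) by simp
    have "((\<lambda>s. c * s powr (1 - \<theta>)) has_real_derivative c * ((1 - \<theta>) * h k powr (1 - \<theta> - 1))) (at (h k))"
      using gap(1) by (intro DERIV_cmult has_real_derivative_powr)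
    then have deriv: "deriv (\<lambda>s. c * s powr (1 - \<theta>)) (h k) = c * ((1 - \<theta>) * h k powr (- \<theta>))"
      by (simp add: DERIV_imp_deriv)
    have "state k \<in> U \<inter> dom_subdifferential potential"
      using r(2) near v(1) by (auto simp: dom_subdifferential_def dist_commute)
    then have "1 \<le> deriv (\<lambda>s. c * s powr (1 - \<theta>)) (h k) * infdist 0 (limiting_subdifferential potential (state k))"
      using KL_near gap by (simp add: h_def)
    also have "\<dots> \<le> c * ((1 - \<theta>) * h k powr (- \<theta>)) * (C * step k)"
      unfolding deriv using infdist pos \<theta> by (intro mult_left_mono) auto
    finally show ?thesis by (simp add: mult_ac)
  qed
  moreover have "h (Suc k) + a * (step (Suc k))\<^sup>2 \<le> h k" if "2 \<le> k" for k
    using a(2)[of k] that by (simp add: h_def)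
  ultimately have "KL_descent state ystar h step \<theta> a (c * C) D r \<nu> 2"
    using a(1) C(1) D pos r(1) \<theta> s step_nonneg
    by unfold_locales (assumption | simp | blast)+
  then show ?thesis unfolding h_def ystar_def by blast
qed

end

theorem proposition1:
  fixes f :: "real^'n \<Rightarrow> real"
    and A :: "real^'n^'m"
    and b :: "real^'m"
    and \<rho> \<gamma> \<eta> \<beta> \<alpha> \<theta> :: real
    and L\<^sub>f :: "real \<Rightarrow> real"
    and x z :: "nat \<Rightarrow> real^'n"
    and l :: "nat \<Rightarrow> real^'m"
    and xstar :: "real^'n"
    and lstar :: "real^'m"
  assumes A_nonzero: "A \<noteq> 0"
    and feasible: "{u. A *v u = b} \<noteq> {}"
    and lsc: "lower_semicontinuous f"
    and weakly_convex: "weakly_convex \<rho> f"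
    and Lipschitz: "implicit_Lipschitz_subgradient \<rho> f L\<^sub>f"
    and gamma: "0 < \<gamma>" "\<gamma> < 1 / \<rho>"
    and eta: "0 < \<eta>" "\<eta> < 2"
    and beta: "\<beta> > 0"
    and alpha_def: "\<alpha> = alpha_meal A \<gamma> \<beta> \<eta>"
    and alpha_less: "\<alpha> < min ((1 - \<gamma> * \<rho>) / (4 * \<gamma> * (1 + \<gamma> * L\<^sub>f \<gamma>)\<^sup>2))
                              (1 / (8 * \<gamma>) * (2 / \<eta> - 1))"
    and meal: "MEAL f A b \<gamma> \<beta> \<eta> x z l"
    and E_bounded: "bdd_below (E_meal f A b \<gamma> \<beta> \<alpha> x z l ` {1..})"
    and iterates_bounded: "bounded (range (\<lambda>k. (x k, z k, l k)))"
    and limit_point: "\<exists>r. strict_mono r \<and> (\<lambda>k. (x (r k), l (r k))) \<longlonglongrightarrow> (xstar, lstar)"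
    and KL: "KL_property (P_meal f A b \<gamma> \<beta> \<alpha>) (xstar, xstar, lstar, xstar) \<theta>"
  shows "(\<lambda>k. (x k, z k, l k)) \<longlonglongrightarrow> (xstar, xstar, lstar) \<and>
    (\<theta> = 0 \<longrightarrow> (\<exists>k\<^sub>0. \<forall>k\<ge>k\<^sub>0. (x k, z k, l k) = (xstar, xstar, lstar))) \<and>
    (0 < \<theta> \<and> \<theta> \<le> 1 / 2 \<longrightarrow>
       (\<exists>k\<^sub>0>0. \<exists>c>0. \<exists>\<tau>. 0 < \<tau> \<and> \<tau> < 1 \<and>
          (\<forall>k\<ge>k\<^sub>0. norm ((x k, z k, l k) - (xstar, xstar, lstar)) \<le> c * \<tau> ^ k))) \<and>
    (1 / 2 < \<theta> \<and> \<theta> < 1 \<longrightarrow>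
       (\<exists>k\<^sub>0>0. \<exists>c>0. \<forall>k\<ge>k\<^sub>0.
          norm ((x k, z k, l k) - (xstar, xstar, lstar))
            \<le> c * real k powr (- ((1 - \<theta>) / (2 * \<theta> - 1)))))"
proof -
  interpret MEAL_run f A b \<rho> \<gamma> \<eta> \<beta> \<alpha> L\<^sub>f x z l
    by unfold_locales (fact assms)+
  obtain a M D r \<nu> where "KL_descent state (xstar, xstar, lstar, xstar)
    (\<lambda>k. potential (state k) - potential (xstar, xstar, lstar, xstar)) step \<theta> a M D r \<nu> 2"
    using KL_descent_state[OF E_bounded limit_point KL] by blast
  then interpret KL_descent state "(xstar, xstar, lstar, xstar)"
    "\<lambda>k. potential (state k) - potential (xstar, xstar, lstar, xstar)" step \<theta> a M D r \<nu> 2 .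
  have proj: "norm ((x k, z k, l k) - (xstar, xstar, lstar)) \<le> dist (state k) (xstar, xstar, lstar, xstar)" for k
    by (simp add: state_def dist_norm norm_Pair)
  show ?thesis
  proof (intro conjI impI)
    have "(\<lambda>k. dist (state k) (xstar, xstar, lstar, xstar)) \<longlonglongrightarrow> 0"
      by (rule tendsto_dist_iff[THEN iffD1, OF convergence])
    then have "(\<lambda>k. (x k, z k, l k) - (xstar, xstar, lstar)) \<longlonglongrightarrow> 0"
      by (rule Lim_null_comparison[OF always_eventually[OF allI[OF proj]]])
    then show "(\<lambda>k. (x k, z k, l k)) \<longlonglongrightarrow> (xstar, xstar, lstar)"
      by (rule LIM_zero_cancel)
  next
    assume "\<theta> = 0"
    from finite_termination[OF this] obtain k\<^sub>0 where "\<forall>k\<ge>k\<^sub>0. state k = (xstar, xstar, lstar, xstar)" ..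
    then have "\<forall>k\<ge>k\<^sub>0. (x k, z k, l k) = (xstar, xstar, lstar)"
      by (simp add: state_def)
    then show "\<exists>k\<^sub>0. \<forall>k\<ge>k\<^sub>0. (x k, z k, l k) = (xstar, xstar, lstar)" ..
  next
    assume "0 < \<theta> \<and> \<theta> \<le> 1 / 2"
    then have "\<theta> \<le> 1 / 2" by simp
    from linear_rate[OF this] obtain k\<^sub>0 c \<tau> where "0 < k\<^sub>0" "0 < c" "0 < \<tau>" "\<tau> < 1"
      and rate: "\<forall>k\<ge>k\<^sub>0. dist (state k) (xstar, xstar, lstar, xstar) \<le> c * \<tau> ^ k"
      by (elim exE conjE)
    moreover have "\<forall>k\<ge>k\<^sub>0. norm ((x k, z k, l k) - (xstar, xstar, lstar)) \<le> c * \<tau> ^ k"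
      by (intro allI impI order_trans[OF proj]) (simp only: rate)
    ultimately show "\<exists>k\<^sub>0>0. \<exists>c>0. \<exists>\<tau>. 0 < \<tau> \<and> \<tau> < 1 \<and>
        (\<forall>k\<ge>k\<^sub>0. norm ((x k, z k, l k) - (xstar, xstar, lstar)) \<le> c * \<tau> ^ k)"
      by (intro exI conjI)
  next
    assume "1 / 2 < \<theta> \<and> \<theta> < 1"
    then have "1 / 2 < \<theta>" by simp
    from sublinear_rate[OF this] obtain k\<^sub>0 c where "0 < k\<^sub>0" "0 < c"
      and rate: "\<forall>k\<ge>k\<^sub>0. dist (state k) (xstar, xstar, lstar, xstar)
        \<le> c * real k powr (- ((1 - \<theta>) / (2 * \<theta> - 1)))"
      by (elim exE conjE)
    moreover have "\<forall>k\<ge>k\<^sub>0. norm ((x k, z k, l k) - (xstar, xstar, lstar))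
        \<le> c * real k powr (- ((1 - \<theta>) / (2 * \<theta> - 1)))"
      by (intro allI impI order_trans[OF proj]) (simp only: rate)
    ultimately show "\<exists>k\<^sub>0>0. \<exists>c>0. \<forall>k\<ge>k\<^sub>0. norm ((x k, z k, l k) - (xstar, xstar, lstar))
        \<le> c * real k powr (- ((1 - \<theta>) / (2 * \<theta> - 1)))"
      by (intro exI conjI)
  qed
qed

end
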